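(* Let $G$ be a $2$-connected cubic graph that has a well connected Kotzig-frame. Then $G$ has a $6$-cycle double cover.
   Context: All graphs are finite and loopless; parallel edges are allowed. A cycle is a connected $2$-regular graph (two parallel edges form a cycle). All $3$-colorings use the colors $1,2,3$; vertex- and edge-colorings need not be proper. An edge-colored cycle is bicolored if its edges carry at most two colors. $d(v,G)$ is the degree of $v$ in $G$. Cycle double covers. A cycle double cover (CDC) of $G$ is a set $S$ of cycles of $G$ such that every edge of $G$ lies in precisely two cycles of $S$. For a cubic graph, a $k$-cycle double cover ($k$-CDC) is a CDC that can be partitioned into $k$ (possibly empty) subsets, each consisting of pairwise edge-disjoint cycles. Kotzig graphs. A Kotzig graph is a cubic graph admitting a proper $3$-edge-coloring in which each bicolored cycle is hamiltonian; such a coloring is called a Kotzig-coloring. A subdivision of a graph $K$ is a graph $K'$ obtained from $K$ by replacing at least one edge $e=vw$ by a $vw$-path $e'$ of length at least $2$. Kotzig-frames. Let $G$ be a $2$-connected cubic graph. A Kotzig-frame of $G$ is a spanning subgraph $F$ of $G$ such that (i) every component of $F$ has an even number of vertices, and (ii) every component of $F$ is either a cycle (a C-component) or a subdivision of a Kotzig graph (a K-component). An edge $e\notin E(F)$ with both endvertices in the same component of $F$ is a chord of $F$; $F^*$ is the set of chords. $G_F$ is the graph obtained from $G$ by contracting every component of $F$ to a distinct vertex and deleting all resulting loops (parallel edges are kept); its edges correspond to the edges of $G-E(F)-F^*$. A vertex of $G_F$ is a C-vertex if it corresponds to a C-component and a K-vertex if it corresponds to a K-component. Perfect colorings. A $3$-total-coloring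 consists of a $3$-edge-coloring and a $3$-vertex-coloring. A $3$-total-coloring of a subdivision $K'$ of a Kotzig graph $K$ is perfect if (i) two edges of $K'$ incident with the same $2$-valent vertex have the same color, (ii) each $2$-valent vertex of $K'$ has the same color as its incident edges, and (iii) the implied $3$-edge-coloring of $K$ (each $e\in E(K)$ gets the color of the edges of the path of $K'$ corresponding to $e$) is a Kotzig-coloring of $K$. A $3$-total-coloring $\alpha$ of a Kotzig-frame $F$ is perfect if its restriction to every K-component is perfect and in each C-component all vertices and edges have the same color (different C-components may have different colors). Well connectedness. Given a Kotzig-frame $F$ of $G$ and a perfect coloring $\alpha$ of $F$, $G_{F,\alpha}$ is the partially edge-colored graph $G_F$ in which each edge corresponding to an edge $vw$ of $G-E(F)-F^*$ with $\alpha(v)=\alpha(w)$ gets color $\alpha(v)$, and all other edges are uncolored. $F$ is well connected if there is a perfect coloring $\alpha$ of $F$ such that $G_{F,\alpha}$ has a connected subgraph $H$ which contains all K-vertices and all of whose edges are colored with one and the same color. *)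

theory Defs
  imports Main
begin

text \<open>
  Finite loopless multigraphs. The incidence function \<open>ends\<close> is total, and a subgraph carries the
  very same incidence function as its host, so that a subgraph of a given graph is determined by
  its vertex set and its edge set.
\<close>

record ('v, 'e) mgraph =
  verts :: "'v set"
  edges :: "'e set"
  ends :: "'e \<Rightarrow> 'v set"

definition multigraph :: "('v, 'e) mgraph \<Rightarrow> bool" where
  "multigraph G \<longleftrightarrow> finite (verts G) \<and> finite (edges G) \<and>
     (\<forall>e\<in>edges G. ends G e \<subseteq> verts G \<and> card (ends G e) = 2)"

definition vdegree :: "'v \<Rightarrow> ('v, 'e) mgraph \<Rightarrow> nat" where
  "vdegree v G = card {e \<in> edges G. v \<in> ends G e}"

definition cubic :: "('v, 'e) mgraph \<Rightarrow> bool" where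
  "cubic G \<longleftrightarrow> (\<forall>v\<in>verts G. vdegree v G = 3)"

definition subgraph :: "('v, 'e) mgraph \<Rightarrow> ('v, 'e) mgraph \<Rightarrow> bool" where
  "subgraph H G \<longleftrightarrow> multigraph H \<and> verts H \<subseteq> verts G \<and> edges H \<subseteq> edges G \<and> ends H = ends G"

definition adjacency :: "('v, 'e) mgraph \<Rightarrow> ('v \<times> 'v) set" where
  "adjacency G = {(u, v). \<exists>e\<in>edges G. ends G e = {u, v}}"

definition graph_connected :: "('v, 'e) mgraph \<Rightarrow> bool" where
  "graph_connected G \<longleftrightarrow> verts G \<noteq> {} \<and> (\<forall>u\<in>verts G. \<forall>v\<in>verts G. (u, v) \<in> (adjacency G)\<^sup>*)"

definition delete_vertex :: "('v, 'e) mgraph \<Rightarrow> 'v \<Rightarrow> ('v, 'e) mgraph" where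
  "delete_vertex G v =
     \<lparr>verts = verts G - {v}, edges = {e \<in> edges G. v \<notin> ends G e}, ends = ends G\<rparr>"

text \<open>
  Connected without cut vertices. As usual for multigraphs, two vertices joined by at least two
  parallel edges count as 2-connected (there are two internally disjoint paths between them), so
  that the cubic graph on two vertices is included.
\<close>

definition two_connected :: "('v, 'e) mgraph \<Rightarrow> bool" where
  "two_connected G \<longleftrightarrow>
     (card (verts G) \<ge> 3 \<or> card (verts G) = 2 \<and> card (edges G) \<ge> 2) \<and>
     graph_connected G \<and> (\<forall>v\<in>verts G. graph_connected (delete_vertex G v))"

definition cycle_graph :: "('v, 'e) mgraph \<Rightarrow> bool" where
  "cycle_graph C \<longleftrightarrow> multigraph C \<and> graph_connected C \<and> (\<forall>v\<in>verts C. vdegree v C = 2)"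

definition path_graph :: "'v \<Rightarrow> 'v \<Rightarrow> ('v, 'e) mgraph \<Rightarrow> bool" where
  "path_graph v w Q \<longleftrightarrow> multigraph Q \<and>
     (\<exists>vs es. distinct vs \<and> length vs = Suc (length es) \<and> hd vs = v \<and> last vs = w \<and>
        (\<forall>i<length es. ends Q (es ! i) = {vs ! i, vs ! Suc i}) \<and>
        verts Q = set vs \<and> edges Q = set es)"

definition component :: "('v, 'e) mgraph \<Rightarrow> ('v, 'e) mgraph \<Rightarrow> bool" where
  "component D G \<longleftrightarrow> subgraph D G \<and> graph_connected D \<and>
     (\<forall>D'. subgraph D' G \<and> graph_connected D' \<and> subgraph D D' \<longrightarrow> D' = D)"


definition cycle_double_cover :: "('v, 'e) mgraph \<Rightarrow> ('v, 'e) mgraph set \<Rightarrow> bool" where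
  "cycle_double_cover G S \<longleftrightarrow>
     (\<forall>C\<in>S. subgraph C G \<and> cycle_graph C) \<and>
     (\<forall>e\<in>edges G. card {C \<in> S. e \<in> edges C} = 2)"

definition k_cycle_double_cover ::
    "nat \<Rightarrow> ('v, 'e) mgraph \<Rightarrow> ('v, 'e) mgraph set \<Rightarrow> bool" where
  "k_cycle_double_cover k G S \<longleftrightarrow> cycle_double_cover G S \<and>
     (\<exists>P :: nat \<Rightarrow> ('v, 'e) mgraph set.
        (\<Union>i<k. P i) = S \<and>
        (\<forall>i<k. \<forall>j<k. i \<noteq> j \<longrightarrow> P i \<inter> P j = {}) \<and>
        (\<forall>i<k. \<forall>C\<in>P i. \<forall>C'\<in>P i. C \<noteq> C' \<longrightarrow> edges C \<inter> edges C' = {}))"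


definition proper_3_edge_coloring :: "('v, 'e) mgraph \<Rightarrow> ('e \<Rightarrow> nat) \<Rightarrow> bool" where
  "proper_3_edge_coloring K c \<longleftrightarrow> (\<forall>e\<in>edges K. c e \<in> {1, 2, 3}) \<and>
     (\<forall>e\<in>edges K. \<forall>f\<in>edges K. e \<noteq> f \<and> ends K e \<inter> ends K f \<noteq> {} \<longrightarrow> c e \<noteq> c f)"

definition bicolored :: "('e \<Rightarrow> nat) \<Rightarrow> ('v, 'e) mgraph \<Rightarrow> bool" where
  "bicolored c C \<longleftrightarrow> card (c ` edges C) \<le> 2"

definition kotzig_coloring :: "('v, 'e) mgraph \<Rightarrow> ('e \<Rightarrow> nat) \<Rightarrow> bool" where
  "kotzig_coloring K c \<longleftrightarrow> proper_3_edge_coloring K c \<and>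
     (\<forall>C. subgraph C K \<and> cycle_graph C \<and> bicolored c C \<longrightarrow> verts C = verts K)"

definition kotzig_graph :: "('v, 'e) mgraph \<Rightarrow> bool" where
  "kotzig_graph K \<longleftrightarrow> multigraph K \<and> verts K \<noteq> {} \<and> cubic K \<and> (\<exists>c. kotzig_coloring K c)"

text \<open>
  \<open>K'\<close> arises from \<open>K\<close> by replacing every edge \<open>e\<close> by the path \<open>P e\<close>, at least one of these paths
  having length at least 2; edges whose path has length 1 are the unsubdivided ones. Taking \<open>K\<close>
  over the same vertex and edge types as \<open>K'\<close> costs no generality when \<open>K\<close> is existentially
  quantified: the vertices of \<open>K\<close> are vertices of \<open>K'\<close>, and an edge of \<open>K\<close> may be named after any
  edge of its path.
\<close>

definition subdivision ::
    "('v, 'e) mgraph \<Rightarrow> ('v, 'e) mgraph \<Rightarrow> ('e \<Rightarrow> ('v, 'e) mgraph) \<Rightarrow> bool" where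
  "subdivision K' K P \<longleftrightarrow> multigraph K \<and> multigraph K' \<and>
     (\<forall>e\<in>edges K. subgraph (P e) K' \<and>
        (\<exists>v w. ends K e = {v, w} \<and> path_graph v w (P e)) \<and>
        verts (P e) \<inter> verts K = ends K e) \<and>
     (\<forall>e\<in>edges K. \<forall>f\<in>edges K. e \<noteq> f \<longrightarrow>
        edges (P e) \<inter> edges (P f) = {} \<and> verts (P e) \<inter> verts (P f) \<subseteq> verts K) \<and>
     verts K' = verts K \<union> (\<Union>e\<in>edges K. verts (P e)) \<and>
     edges K' = (\<Union>e\<in>edges K. edges (P e)) \<and>
     (\<exists>e\<in>edges K. card (edges (P e)) \<ge> 2)"

definition kotzig_subdivision :: "('v, 'e) mgraph \<Rightarrow> bool" where
  "kotzig_subdivision K' \<longleftrightarrow> (\<exists>K P. kotzig_graph K \<and> subdivision K' K P)"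


definition C_component :: "('v, 'e) mgraph \<Rightarrow> ('v, 'e) mgraph \<Rightarrow> bool" where
  "C_component D F \<longleftrightarrow> component D F \<and> cycle_graph D"

definition K_component :: "('v, 'e) mgraph \<Rightarrow> ('v, 'e) mgraph \<Rightarrow> bool" where
  "K_component D F \<longleftrightarrow> component D F \<and> kotzig_subdivision D"

definition kotzig_frame :: "('v, 'e) mgraph \<Rightarrow> ('v, 'e) mgraph \<Rightarrow> bool" where
  "kotzig_frame G F \<longleftrightarrow> subgraph F G \<and> verts F = verts G \<and>
     (\<forall>D. component D F \<longrightarrow> even (card (verts D)) \<and> (C_component D F \<or> K_component D F))"

definition chords :: "('v, 'e) mgraph \<Rightarrow> ('v, 'e) mgraph \<Rightarrow> 'e set" where
  "chords G F = {e \<in> edges G - edges F. \<exists>D. component D F \<and> ends G e \<subseteq> verts D}"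

text \<open>
  The contracted graph: its vertices are the components of \<open>F\<close>, and each remaining edge joins the
  components containing its two endvertices in \<open>G\<close>.
\<close>

definition contracted :: "('v, 'e) mgraph \<Rightarrow> ('v, 'e) mgraph \<Rightarrow> (('v, 'e) mgraph, 'e) mgraph" where
  "contracted G F =
     \<lparr>verts = {D. component D F},
      edges = edges G - edges F - chords G F,
      ends = (\<lambda>e. {D. component D F \<and> ends G e \<inter> verts D \<noteq> {}})\<rparr>"


record ('v, 'e) total_coloring =
  vcol :: "'v \<Rightarrow> nat"
  ecol :: "'e \<Rightarrow> nat"

definition three_total_coloring :: "('v, 'e) mgraph \<Rightarrow> ('v, 'e) total_coloring \<Rightarrow> bool" where
  "three_total_coloring G \<alpha> \<longleftrightarrow>
     (\<forall>v\<in>verts G. vcol \<alpha> v \<in> {1, 2, 3}) \<and> (\<forall>e\<in>edges G. ecol \<alpha> e \<in> {1, 2, 3})"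

text \<open>
  In the last condition, \<open>c\<close> is the edge coloring of \<open>K\<close> implied by \<open>\<alpha>\<close>; the cubic graph \<open>K\<close> and
  the paths \<open>P\<close> are determined by \<open>K'\<close> up to renaming the edges of \<open>K\<close>.
\<close>

definition perfect_subdivision_coloring ::
    "('v, 'e) mgraph \<Rightarrow> ('v, 'e) total_coloring \<Rightarrow> bool" where
  "perfect_subdivision_coloring K' \<alpha> \<longleftrightarrow> three_total_coloring K' \<alpha> \<and>
     (\<forall>v\<in>verts K'. vdegree v K' = 2 \<longrightarrow>
        (\<forall>e\<in>edges K'. \<forall>f\<in>edges K'. v \<in> ends K' e \<and> v \<in> ends K' f \<longrightarrow> ecol \<alpha> e = ecol \<alpha> f)) \<and>
     (\<forall>v\<in>verts K'. vdegree v K' = 2 \<longrightarrow>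
        (\<forall>e\<in>edges K'. v \<in> ends K' e \<longrightarrow> vcol \<alpha> v = ecol \<alpha> e)) \<and>
     (\<exists>K P c. kotzig_graph K \<and> subdivision K' K P \<and>
        (\<forall>e\<in>edges K. \<forall>f\<in>edges (P e). c e = ecol \<alpha> f) \<and> kotzig_coloring K c)"

definition perfect_coloring :: "('v, 'e) mgraph \<Rightarrow> ('v, 'e) total_coloring \<Rightarrow> bool" where
  "perfect_coloring F \<alpha> \<longleftrightarrow> three_total_coloring F \<alpha> \<and>
     (\<forall>D. K_component D F \<longrightarrow> perfect_subdivision_coloring D \<alpha>) \<and>
     (\<forall>D. C_component D F \<longrightarrow>
        (\<exists>c. (\<forall>v\<in>verts D. vcol \<alpha> v = c) \<and> (\<forall>e\<in>edges D. ecol \<alpha> e = c)))"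

text \<open>The partial edge coloring of \<open>contracted G F\<close>; \<open>None\<close> means uncolored.\<close>

definition contracted_color ::
    "('v, 'e) mgraph \<Rightarrow> ('v, 'e) total_coloring \<Rightarrow> 'e \<Rightarrow> nat option" where
  "contracted_color G \<alpha> e =
     (if \<exists>c. vcol \<alpha> ` ends G e = {c} then Some (the_elem (vcol \<alpha> ` ends G e)) else None)"

definition well_connected :: "('v, 'e) mgraph \<Rightarrow> ('v, 'e) mgraph \<Rightarrow> bool" where
  "well_connected G F \<longleftrightarrow>
     (\<exists>\<alpha>. perfect_coloring F \<alpha> \<and>
        (\<exists>H c. subgraph H (contracted G F) \<and> graph_connected H \<and>
           {D. K_component D F} \<subseteq> verts H \<and>
           (\<forall>e\<in>edges H. contracted_color G \<alpha> e = Some c)))"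

end

theory Submission
  imports Defs "HOL-Combinatorics.Transposition"
begin

text \<open>
  Two observations reduce the theorem to a parity problem. A family of six edge sets of a cubic graph
  that have even degrees and cover each edge exactly twice decomposes into a 6-cycle double cover
  (\<open>k_cycle_double_cover_of_even_edge_sets\<close>). And such sets come in three pairs, one for each colour
  \<open>h\<close>: the edges of the frame that do not have colour \<open>h\<close> form disjoint cycles, one or none in each
  component, because Kotzig colorings make bicolored cycles hamiltonian. If every such cycle contains
  an even number of ends of a matching \<open>M\<close> of non-frame edges, then its segments between these ends
  can be coloured alternately, and \<open>M\<close> together with either class of segments is even. The pair covers
  \<open>M\<close> twice and the cycles once, and each frame edge belongs to the cycles for two of the three
  colours (\<open>six_even_edge_sets\<close>).

  It remains to distribute the non-frame edges over the colours \<open>h\<close>. An edge may go to \<open>h\<close> if neither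
  of its ends has colour \<open>h\<close>, and each component must receive an even number of ends for each \<open>h\<close>.
  Every component has an even number of ends in total, so two of the three parities imply the third.
  Let \<open>c\<close> be the colour of the connected subgraph \<open>H\<close> that contains all K-vertices. The parities for
  \<open>h = c\<close> concern only edges that avoid \<open>c\<close>, and they can be made even after exchanging the other two
  colours on suitable components (\<open>switching_even_extension\<close>). The edges of \<open>H\<close> may go to either of
  these two other colours, so connectedness of \<open>H\<close> lets a join in \<open>H\<close> repair the second parity
  at all components in \<open>H\<close>. The components outside \<open>H\<close> are cycles and can be given a colour other than
  \<open>c\<close>; their second parity is then automatic (\<open>parity_assignment\<close>).
\<close>

section \<open>Joins\<close>

text \<open>
  The endpoint maps \<open>p\<close> and \<open>q\<close> orient a multigraph arbitrarily. Composing them with a map on the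
  vertices contracts the graph without touching its edges, and a loop counts twice; this makes one
  parity calculus serve both the graph itself and the graph of its frame components.
\<close>

definition half_degree :: "('e \<Rightarrow> 'a) \<Rightarrow> ('e \<Rightarrow> 'a) \<Rightarrow> 'e set \<Rightarrow> 'a \<Rightarrow> nat" where
  "half_degree p q J x = card {e \<in> J. p e = x} + card {e \<in> J. q e = x}"

definition edge_closed :: "('e \<Rightarrow> 'a) \<Rightarrow> ('e \<Rightarrow> 'a) \<Rightarrow> 'e set \<Rightarrow> 'a set \<Rightarrow> bool" where
  "edge_closed p q E Z \<longleftrightarrow> (\<forall>e\<in>E. p e \<in> Z \<longleftrightarrow> q e \<in> Z)"

lemma sum_card_fibres:
  assumes "finite Z" "finite J"
  shows "(\<Sum>x\<in>Z. card {e \<in> J. f e = x}) = card {e \<in> J. f e \<in> Z}"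
  using assms(1)
proof (induction Z rule: finite_induct)
  case (insert x Z)
  have "{e \<in> J. f e \<in> insert x Z} = {e \<in> J. f e = x} \<union> {e \<in> J. f e \<in> Z}" by auto
  then show ?case
    using insert assms(2) by (simp add: card_Un_disjoint disjoint_iff)
qed simp

lemma sum_half_degree:
  assumes "finite Z" "finite J"
  shows "(\<Sum>x\<in>Z. half_degree p q J x) = card {e \<in> J. p e \<in> Z} + card {e \<in> J. q e \<in> Z}"
  using assms by (simp add: half_degree_def sum.distrib sum_card_fibres)

lemma half_degree_Un:
  assumes "finite J" "finite J'" "J \<inter> J' = {}"
  shows "half_degree p q (J \<union> J') x = half_degree p q J x + half_degree p q J' x"
proof -
  have "card {e \<in> J \<union> J'. f e = x} = card {e \<in> J. f e = x} + card {e \<in> J'. f e = x}"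
    for f :: "'a \<Rightarrow> 'b"
  proof -
    have "{e \<in> J \<union> J'. f e = x} = {e \<in> J. f e = x} \<union> {e \<in> J'. f e = x}" by auto
    then show ?thesis using assms by (simp add: card_Un_disjoint disjoint_iff)
  qed
  then show ?thesis by (simp add: half_degree_def)
qed

lemma even_sum_half_degree_closed:
  assumes "finite Z" "finite J" "edge_closed p q J Z"
  shows "even (\<Sum>x\<in>Z. half_degree p q J x)"
proof -
  have "{e \<in> J. p e \<in> Z} = {e \<in> J. q e \<in> Z}"
    using assms(3) by (auto simp: edge_closed_def)
  then show ?thesis using sum_half_degree[OF assms(1,2)] by simp
qed

lemma even_sum_sym_diff:
  fixes t :: "'a \<Rightarrow> nat"
  assumes "finite Y" "finite Z"
  shows "even (sum t ((Y - Z) \<union> (Z - Y))) \<longleftrightarrow> even (sum t Y + sum t Z)"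
proof -
  have "sum t ((Y - Z) \<union> (Z - Y)) = sum t (Y - Z) + sum t (Z - Y)"
    using assms by (intro sum.union_disjoint) auto
  moreover have "sum t Y = sum t (Y \<inter> Z) + sum t (Y - Z)"
    using assms by (simp add: sum.Int_Diff)
  moreover have "sum t Z = sum t (Z \<inter> Y) + sum t (Z - Y)"
    using assms by (simp add: sum.Int_Diff)
  ultimately show ?thesis by (simp add: Int_commute) presburger
qed

text \<open>
  A target parity \<open>t\<close> is realised by an edge set as soon as its sum is even on every union of
  connected components. Induction on the edges replaces the usual argument with paths: if adding
  \<open>e\<close> is what makes the hypothesis true, then some set \<open>Z\<close> closed under the other edges has odd sum,
  so \<open>e\<close> must be used. After toggling \<open>t\<close> at both ends of \<open>e\<close> the hypothesis holds without \<open>e\<close>,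
  because any set that \<open>e\<close> leaves differs from \<open>Z\<close> by a set that \<open>e\<close> does not leave.
\<close>

lemma join_exists:
  fixes t :: "'a \<Rightarrow> nat"
  assumes "finite E" "finite V"
    and "\<And>Z. Z \<subseteq> V \<Longrightarrow> edge_closed p q E Z \<Longrightarrow> even (sum t Z)"
  shows "\<exists>J\<subseteq>E. \<forall>x\<in>V. even (t x + half_degree p q J x)"
  using assms(1,3)
proof (induction E arbitrary: t rule: finite_induct)
  case empty
  have "even (t x)" if "x \<in> V" for x
    using empty[of "{x}"] that by (simp add: edge_closed_def)
  then show ?case by (auto simp: half_degree_def)
next
  case (insert e E)
  show ?case
  proof (cases "\<forall>Z\<subseteq>V. edge_closed p q E Z \<longrightarrow> even (sum t Z)")
    case True
    then obtain J where "J \<subseteq> E" "\<forall>x\<in>V. even (t x + half_degree p q J x)"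
      using insert.IH[of t] by metis
    then show ?thesis by (meson subset_insertI2)
  next
    case False
    then obtain Z where Z: "Z \<subseteq> V" "edge_closed p q E Z" "odd (sum t Z)" by blast
    then have eZ: "p e \<in> Z \<longleftrightarrow> q e \<notin> Z"
      using insert.prems[of Z] by (auto simp: edge_closed_def)
    define t' where "t' x = t x + half_degree p q {e} x" for x
    have sum_t': "sum t' Y = sum t Y + of_bool (p e \<in> Y) + of_bool (q e \<in> Y)" if "Y \<subseteq> V" for Y
    proof -
      have "finite Y" using that assms(2) finite_subset by blast
      moreover have "card {e' \<in> {e}. f e' \<in> Y} = of_bool (f e \<in> Y)" for f :: "'b \<Rightarrow> 'a"
      proof -
        have "{e' \<in> {e}. f e' \<in> Y} = (if f e \<in> Y then {e} else {})" by auto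
        then show ?thesis by simp
      qed
      ultimately show ?thesis
        by (simp add: t'_def sum.distrib sum_half_degree del: singleton_iff)
    qed
    have "even (sum t' Y)" if Y: "Y \<subseteq> V" "edge_closed p q E Y" for Y
    proof (cases "p e \<in> Y \<longleftrightarrow> q e \<in> Y")
      case True
      then have "even (sum t Y)"
        using Y insert.prems[of Y] by (auto simp: edge_closed_def)
      then show ?thesis using True sum_t'[OF Y(1)] by simp
    next
      case False
      let ?X = "(Y - Z) \<union> (Z - Y)"
      have "edge_closed p q (insert e E) ?X"
        using False eZ Y(2) Z(2) by (auto simp: edge_closed_def)
      then have "even (sum t ?X)" using insert.prems[of ?X] Y Z by blast
      then have "even (sum t Y + sum t Z)"
        using even_sum_sym_diff[of Y Z t] Y Z assms(2) finite_subset by blast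
      then have "odd (sum t Y)" using Z by simp
      then show ?thesis using False sum_t'[OF Y(1)] by auto
    qed
    then obtain J where J: "J \<subseteq> E" "\<forall>x\<in>V. even (t' x + half_degree p q J x)"
      using insert.IH[of t'] by blast
    have "half_degree p q (insert e J) x = half_degree p q {e} x + half_degree p q J x" for x
    proof -
      have "finite J" using J(1) insert.hyps(1) by (rule finite_subset)
      moreover have "e \<notin> J" using J(1) insert.hyps(2) by auto
      ultimately show ?thesis using half_degree_Un[of "{e}" J p q x] by simp
    qed
    then have "\<forall>x\<in>V. even (t x + half_degree p q (insert e J) x)"
      using J(2) by (simp add: t'_def add.assoc)
    then show ?thesis using J(1) by (intro exI[of _ "insert e J"]) auto
  qed
qed

section \<open>Switching signed graphs\<close>

text \<open>
  A signed graph can be switched at a vertex set \<open>W\<close> so that its negative edges extend to an even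
  edge set. Choose \<open>W\<close> with as few negative edges as possible. Switching a set \<open>Z\<close> that no positive
  edge leaves turns all edges leaving \<open>Z\<close> positive and changes no other sign, so by minimality
  no edge leaves \<open>Z\<close> at all. Hence the negative degrees have even sum on \<open>Z\<close>, and positive edges can
  correct them.
\<close>

lemma switching_even_extension:
  assumes "finite E" "finite V"
  shows "\<exists>W N. N \<subseteq> E \<and> {e \<in> E. s e \<noteq> ((p e \<in> W) \<noteq> (q e \<in> W))} \<subseteq> N \<and>
           (\<forall>x\<in>V. even (half_degree p q N x))"
proof -
  define neg where "neg W = {e \<in> E. s e \<noteq> ((p e \<in> W) \<noteq> (q e \<in> W))}" for W
  obtain W where W: "\<And>W'. card (neg W) \<le> card (neg W')"
    using ex_has_least_nat[of "\<lambda>_. True" _ "\<lambda>W. card (neg W)"] by auto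
  have fin: "finite (neg W)" for W using assms(1) by (simp add: neg_def)
  have "even (sum (half_degree p q (neg W)) Z)"
    if Z: "Z \<subseteq> V" "edge_closed p q (E - neg W) Z" for Z
  proof -
    let ?W = "(W - Z) \<union> (Z - W)"
    have "neg ?W \<subseteq> neg W"
      using Z(2) by (auto simp: neg_def edge_closed_def)
    then have eq: "neg ?W = neg W" by (rule card_seteq[OF fin _ W])
    have "edge_closed p q (neg W) Z"
      unfolding edge_closed_def
    proof
      fix e assume "e \<in> neg W"
      then have "e \<in> neg W" "e \<in> neg ?W" using eq by auto
      then show "p e \<in> Z \<longleftrightarrow> q e \<in> Z" by (auto simp: neg_def)
    qed
    then show ?thesis
      using even_sum_half_degree_closed[of Z "neg W"] fin Z(1) assms(2) finite_subset by blast
  qed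
  then obtain J where J: "J \<subseteq> E - neg W"
      "\<forall>x\<in>V. even (half_degree p q (neg W) x + half_degree p q J x)"
    using join_exists[of "E - neg W" V p q "half_degree p q (neg W)"] assms by auto
  have "finite J" using J(1) assms(1) finite_subset by blast
  moreover have "neg W \<inter> J = {}" using J(1) by auto
  ultimately have "\<forall>x\<in>V. even (half_degree p q (neg W \<union> J) x)"
    using J(2) half_degree_Un[OF fin] by metis
  moreover have "neg W \<union> J \<subseteq> E" using J(1) by (auto simp: neg_def)
  ultimately show ?thesis unfolding neg_def by blast
qed

section \<open>Distributing the connecting edges over the three colours\<close>

text \<open>
  Every edge \<open>e\<close> has to be given a colour \<open>\<mu> e\<close> different from the colours of
  its ends, such that each class \<open>\<kappa>\<close> sees each value of \<open>\<mu>\<close> evenly often. The value is forced if the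
  end colours differ, and there are two choices if they agree. The freedom that remains is to exchange
  \<open>a\<close> and \<open>b\<close> on a set \<open>W\<close> of classes.

  Value \<open>c\<close> is settled first: it is possible exactly on the edges whose ends are coloured \<open>a\<close> or \<open>b\<close>,
  and forced if these colours differ, so it is a switching problem for a signed graph. Value \<open>a\<close> is
  settled next by a join inside the connected graph \<open>(HV, EH)\<close>, whose edges have both ends
  coloured \<open>c\<close> and hence choose freely between \<open>a\<close> and \<open>b\<close>. A class outside \<open>HV\<close> uses only one of the
  colours \<open>a\<close>, \<open>b\<close>, so only two values of \<open>\<mu>\<close> occur there, and one of them is \<open>c\<close>. The remaining value
  is even because the total is.
\<close>

lemma parity_assignment:
  fixes p q :: "'e \<Rightarrow> 'v" and \<kappa> :: "'v \<Rightarrow> 'c" and vc :: "'v \<Rightarrow> nat"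
  assumes E: "finite E" and V: "finite V" "HV \<subseteq> V"
    and in_V: "\<And>e. e \<in> E \<Longrightarrow> \<kappa> (p e) \<in> V \<and> \<kappa> (q e) \<in> V"
    and abc: "a \<noteq> b" "a \<noteq> c" "b \<noteq> c"
    and col: "\<And>e. e \<in> E \<Longrightarrow> vc (p e) \<in> {a, b, c} \<and> vc (q e) \<in> {a, b, c}"
    and total: "\<And>x. x \<in> V \<Longrightarrow> even (half_degree (\<kappa> \<circ> p) (\<kappa> \<circ> q) E x)"
    and EH: "EH \<subseteq> E"
    and EH': "\<And>e. e \<in> EH \<Longrightarrow> \<kappa> (p e) \<in> HV \<and> \<kappa> (q e) \<in> HV \<and> vc (p e) = c \<and> vc (q e) = c"
    and conn: "\<And>Z. Z \<subseteq> HV \<Longrightarrow> edge_closed (\<kappa> \<circ> p) (\<kappa> \<circ> q) EH Z \<Longrightarrow> Z = {} \<or> Z = HV"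
    and outside: "\<And>v. \<kappa> v \<in> V - HV \<Longrightarrow> vc v = a"
  shows "\<exists>W \<mu>. let vc' = (\<lambda>v. if \<kappa> v \<in> W then transpose a b (vc v) else vc v) in
     (\<forall>e\<in>E. \<mu> e \<in> {a, b, c} - {vc' (p e), vc' (q e)}) \<and>
     (\<forall>x\<in>V. \<forall>h\<in>{a, b, c}. even (half_degree (\<kappa> \<circ> p) (\<kappa> \<circ> q) {e \<in> E. \<mu> e = h} x))"
proof -
  let ?d = "half_degree (\<kappa> \<circ> p) (\<kappa> \<circ> q)"
  define R where "R = {e \<in> E. vc (p e) \<noteq> c \<and> vc (q e) \<noteq> c}"
  have finR: "finite R" using E by (simp add: R_def)
  obtain W N where N: "N \<subseteq> R" "\<And>x. x \<in> V \<Longrightarrow> even (?d N x)"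
    and neg: "{e \<in> R. (vc (p e) \<noteq> vc (q e)) \<noteq> ((\<kappa> (p e) \<in> W) \<noteq> (\<kappa> (q e) \<in> W))} \<subseteq> N"
    using switching_even_extension[OF finR V(1), of "\<lambda>e. vc (p e) \<noteq> vc (q e)" "\<kappa> \<circ> p" "\<kappa> \<circ> q"]
    by auto
  define vc' where "vc' = (\<lambda>v. if \<kappa> v \<in> W then transpose a b (vc v) else vc v)"
  have c_iff: "vc' v = c \<longleftrightarrow> vc v = c" for v
    using abc by (auto simp: vc'_def transpose_def)
  have col': "vc' (p e) \<in> {a, b, c}" "vc' (q e) \<in> {a, b, c}" if "e \<in> E" for e
    using col[OF that] by (auto simp: vc'_def transpose_def)
  have neg': "e \<in> N" if e: "e \<in> E" "{vc' (p e), vc' (q e)} = {a, b}" for e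
  proof -
    have ends: "vc' (p e) = a \<and> vc' (q e) = b \<or> vc' (p e) = b \<and> vc' (q e) = a"
      using e(2) by (simp add: doubleton_eq_iff)
    then have "vc' (p e) \<noteq> c" "vc' (q e) \<noteq> c" "vc' (p e) \<noteq> vc' (q e)"
      using abc by metis+
    then have "e \<in> R" using e(1) c_iff by (simp add: R_def)
    then have "vc (p e) \<in> {a, b}" "vc (q e) \<in> {a, b}"
      using col[of e] by (auto simp: R_def)
    then have "vc (p e) = a \<or> vc (p e) = b" "vc (q e) = a \<or> vc (q e) = b" by auto
    then have "(vc (p e) \<noteq> vc (q e)) \<noteq> ((\<kappa> (p e) \<in> W) \<noteq> (\<kappa> (q e) \<in> W))"
      using \<open>vc' (p e) \<noteq> vc' (q e)\<close> abc(1)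
      by (elim disjE) (simp_all add: vc'_def split: if_splits)
    then have "e \<in> {e \<in> R. (vc (p e) \<noteq> vc (q e)) \<noteq> ((\<kappa> (p e) \<in> W) \<noteq> (\<kappa> (q e) \<in> W))}"
      using \<open>e \<in> R\<close> by simp
    then show ?thesis using neg by blast
  qed
  \<comment> \<open>the edges outside \<open>N\<close> that are forced to take the value \<open>a\<close>\<close>
  define B where "B = {e \<in> E - N. vc' (p e) = b \<or> vc' (q e) = b}"
  have NE: "N \<subseteq> E" using N(1) by (auto simp: R_def)
  have fin: "finite N" "finite B" "finite EH" "finite HV"
    using E EH NE V finite_subset by (auto simp: B_def intro: finite_subset)
  have B_not_a: "vc' (p e) \<noteq> a \<and> vc' (q e) \<noteq> a" if "e \<in> B" for e
    using that neg'[of e] abc(1) by (auto simp: B_def insert_commute)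
  have B_outside: "even (?d B x)" if x: "x \<in> V - HV" for x
  proof (cases "x \<in> W")
    case False
    have "{e \<in> B. (\<kappa> \<circ> r) e = x} = {}" if r: "r = p \<or> r = q" for r
    proof -
      have "vc' (r e) \<noteq> a" if "e \<in> B" for e using B_not_a[OF that] r by auto
      moreover have "vc' (r e) = a" if "\<kappa> (r e) = x" for e
        using False outside[of "r e"] x that by (simp add: vc'_def)
      ultimately show ?thesis by auto
    qed
    from this[of p] this[of q] show ?thesis
      by (simp only: half_degree_def simp_thms card.empty) simp
  next
    case True
    have at_x: "vc' v = b" if "\<kappa> v = x" for v
      using outside[of v] x that True by (simp add: vc'_def)
    have "{e \<in> B \<union> N. (\<kappa> \<circ> r) e = x} = {e \<in> E. (\<kappa> \<circ> r) e = x}" if "r = p \<or> r = q" for r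
      using that at_x NE by (auto simp: B_def)
    then have "?d E x = ?d (B \<union> N) x" by (simp only: half_degree_def simp_thms)
    also have "\<dots> = ?d B x + ?d N x" by (rule half_degree_Un) (use fin in \<open>auto simp: B_def\<close>)
    finally show ?thesis using total[of x] N(2)[of x] x by simp
  qed
  have B_sum: "even (sum (?d B) HV)"
  proof -
    have "sum (?d B) V = sum (?d B) (V - HV) + sum (?d B) HV"
      by (rule sum.subset_diff[OF V(2,1)])
    moreover have "even (sum (?d B) (V - HV))" using B_outside by (rule dvd_sum)
    moreover have "even (sum (?d B) V)"
      using in_V by (intro even_sum_half_degree_closed V(1) fin) (auto simp: B_def edge_closed_def)
    ultimately show ?thesis by simp
  qed
  obtain J where J: "J \<subseteq> EH" "\<And>x. x \<in> HV \<Longrightarrow> even (?d B x + ?d J x)"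
    using join_exists[of EH HV "\<kappa> \<circ> p" "\<kappa> \<circ> q" "?d B"] fin conn B_sum by (metis sum.empty even_zero)
  have finJ: "finite J" using J(1) fin(3) finite_subset by blast
  have BJ: "B \<inter> J = {}" and NJ: "N \<inter> J = {}"
  proof -
    have "vc' (p e) = c \<and> vc' (q e) = c" if "e \<in> J" for e
      using EH'[of e] J(1) that c_iff by blast
    then show "B \<inter> J = {}" "N \<inter> J = {}" using abc N(1) c_iff by (auto simp: B_def R_def)
  qed
  define \<mu> where "\<mu> e = (if e \<in> N then c else if e \<in> B \<union> J then a else b)" for e
  have \<mu>_c: "{e \<in> E. \<mu> e = c} = N" using NE abc by (auto simp: \<mu>_def)
  have \<mu>_a: "{e \<in> E. \<mu> e = a} = B \<union> J"
    using NE abc J(1) EH BJ NJ by (auto simp: \<mu>_def B_def)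
  have "\<mu> e \<in> {a, b, c} - {vc' (p e), vc' (q e)}" if e: "e \<in> E" for e
  proof -
    consider "e \<in> N" | "e \<in> B" | "e \<in> J" | "e \<notin> N" "e \<notin> B" "e \<notin> J" by blast
    then show ?thesis
    proof cases
      case 1 then show ?thesis using N(1) c_iff by (auto simp: \<mu>_def R_def)
    next
      case 2 then show ?thesis using B_not_a[of e] by (auto simp: \<mu>_def B_def)
    next
      case 3
      then have "vc' (p e) = c \<and> vc' (q e) = c" using EH'[of e] J(1) c_iff by blast
      then show ?thesis using 3 NJ abc by (auto simp: \<mu>_def)
    next
      case 4 then show ?thesis using e by (auto simp: \<mu>_def B_def)
    qed
  qed
  moreover have "even (?d {e \<in> E. \<mu> e = h} x)" if x: "x \<in> V" and h: "h \<in> {a, b, c}" for x h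
  proof -
    have ev_c: "even (?d {e \<in> E. \<mu> e = c} x)" using \<mu>_c N(2) x by simp
    have ev_a: "even (?d {e \<in> E. \<mu> e = a} x)"
    proof -
      have "?d (B \<union> J) x = ?d B x + ?d J x" by (rule half_degree_Un[OF fin(2) finJ BJ])
      moreover have "?d J x = 0" if "x \<notin> HV"
      proof -
        have "{e \<in> J. (\<kappa> \<circ> p) e = x} = {}" "{e \<in> J. (\<kappa> \<circ> q) e = x} = {}"
          using that EH' J(1) by fastforce+
        then show ?thesis by (simp only: half_degree_def) simp
      qed
      ultimately show ?thesis using \<mu>_a J(2) B_outside x by (cases "x \<in> HV") auto
    qed
    have "E = ({e \<in> E. \<mu> e = a} \<union> {e \<in> E. \<mu> e = c}) \<union> {e \<in> E. \<mu> e = b}"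
      by (auto simp: \<mu>_def)
    then have "?d E x = ?d (({e \<in> E. \<mu> e = a} \<union> {e \<in> E. \<mu> e = c}) \<union> {e \<in> E. \<mu> e = b}) x"
      by simp
    also have "\<dots> = ?d ({e \<in> E. \<mu> e = a} \<union> {e \<in> E. \<mu> e = c}) x + ?d {e \<in> E. \<mu> e = b} x"
      using E abc by (intro half_degree_Un) auto
    also have "?d ({e \<in> E. \<mu> e = a} \<union> {e \<in> E. \<mu> e = c}) x =
        ?d {e \<in> E. \<mu> e = a} x + ?d {e \<in> E. \<mu> e = c} x"
      using E abc by (intro half_degree_Un) auto
    finally have "even (?d {e \<in> E. \<mu> e = b} x)" using total[OF x] ev_a ev_c by (simp only: even_add simp_thms)
    moreover have "h = a \<or> h = b \<or> h = c" using h by blast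
    ultimately show ?thesis using ev_a ev_c by (elim disjE) simp_all
  qed
  ultimately show ?thesis unfolding Let_def vc'_def by blast
qed

section \<open>Connected subgraphs and components\<close>

lemma ends_eq_pair:
  assumes "multigraph G"
  shows "\<exists>p q. \<forall>e\<in>edges G. ends G e = {p e, q e} \<and> p e \<noteq> q e"
proof -
  have "\<forall>e\<in>edges G. \<exists>x. ends G e = {fst x, snd x} \<and> fst x \<noteq> snd x"
    using assms by (auto simp: multigraph_def card_2_iff)
  then obtain f where "\<forall>e\<in>edges G. ends G e = {fst (f e), snd (f e)} \<and> fst (f e) \<noteq> snd (f e)"
    by (rule bchoice[THEN exE])
  then show ?thesis by (intro exI[of _ "\<lambda>e. fst (f e)"] exI[of _ "\<lambda>e. snd (f e)"])
qed

lemma connected_subset: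
  assumes "graph_connected C" "x \<in> verts C" "x \<in> X"
    and closed: "\<And>e. e \<in> edges C \<Longrightarrow> ends C e \<inter> X \<noteq> {} \<Longrightarrow> ends C e \<subseteq> X"
  shows "verts C \<subseteq> X"
proof
  fix y assume "y \<in> verts C"
  then have "(x, y) \<in> (adjacency C)\<^sup>*" using assms by (auto simp: graph_connected_def)
  then show "y \<in> X"
  proof (induction rule: rtrancl_induct)
    case (step y z)
    then show ?case using closed by (fastforce simp: adjacency_def)
  qed (fact assms(3))
qed

lemma adjacency_sym: "sym (adjacency G)"
  by (auto simp: sym_def adjacency_def insert_commute)

text \<open>
  The component of a vertex, as an explicit graph: maximality with respect to \<open>subgraph\<close> follows from
  closure under adjacency.
\<close>

definition component_at :: "('v, 'e) mgraph \<Rightarrow> 'v \<Rightarrow> ('v, 'e) mgraph" where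
  "component_at G u =
     \<lparr>verts = {x. (u, x) \<in> (adjacency G)\<^sup>*},
      edges = {e \<in> edges G. ends G e \<subseteq> {x. (u, x) \<in> (adjacency G)\<^sup>*}},
      ends = ends G\<rparr>"

lemma edge_pair:
  assumes "multigraph G" "e \<in> edges G" "x \<in> ends G e"
  obtains y where "ends G e = {x, y}" "x \<noteq> y"
proof -
  have "card (ends G e) = 2" using assms by (auto simp: multigraph_def)
  then obtain y z where "ends G e = {y, z}" "y \<noteq> z" by (auto simp: card_2_iff)
  then show ?thesis using assms(3) that[of y] that[of z] by (auto simp: insert_commute)
qed

lemma edge_has_end:
  assumes "multigraph G" "e \<in> edges G"
  obtains v where "v \<in> ends G e" "v \<in> verts G"
proof -
  have "card (ends G e) = 2" "ends G e \<subseteq> verts G" using assms by (auto simp: multigraph_def)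
  then have "ends G e \<noteq> {}" by auto
  then show ?thesis using \<open>ends G e \<subseteq> verts G\<close> that by blast
qed

lemma component_at_closed:
  assumes "multigraph G" "e \<in> edges G" "ends G e \<inter> verts (component_at G u) \<noteq> {}"
  shows "e \<in> edges (component_at G u)"
proof -
  obtain x where x: "x \<in> ends G e" "(u, x) \<in> (adjacency G)\<^sup>*"
    using assms(3) by (auto simp: component_at_def)
  obtain y where y: "ends G e = {x, y}" using edge_pair[OF assms(1,2) x(1)] .
  then have "(x, y) \<in> adjacency G" using assms(2) by (auto simp: adjacency_def)
  then have "(u, y) \<in> (adjacency G)\<^sup>*" using x(2) by simp
  then show ?thesis using assms(2) x y by (simp add: component_at_def)
qed

lemma component_at_subgraph:
  assumes "multigraph G" "u \<in> verts G"
  shows "subgraph (component_at G u) G"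
proof -
  have "x \<in> verts G" if "(u, x) \<in> (adjacency G)\<^sup>*" for x
    using that
  proof (induction rule: rtrancl_induct)
    case (step y z)
    then show ?case using assms(1) by (fastforce simp: adjacency_def multigraph_def)
  qed (fact assms(2))
  then have "{x. (u, x) \<in> (adjacency G)\<^sup>*} \<subseteq> verts G" by auto
  then show ?thesis
    using assms(1) finite_subset by (auto simp: subgraph_def multigraph_def component_at_def)
qed

lemma component_at_connected:
  assumes "multigraph G" "u \<in> verts G"
  shows "graph_connected (component_at G u)"
proof -
  let ?C = "component_at G u"
  have reach: "(u, x) \<in> (adjacency ?C)\<^sup>*" if "(u, x) \<in> (adjacency G)\<^sup>*" for x
    using that
  proof (induction rule: rtrancl_induct)
    case (step y z)
    then have "(u, z) \<in> (adjacency G)\<^sup>*" by simp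
    moreover obtain e where "e \<in> edges G" "ends G e = {y, z}"
      using step(2) by (auto simp: adjacency_def)
    ultimately have "e \<in> edges ?C" "ends ?C e = {y, z}"
      using step(1) by (simp_all add: component_at_def)
    then have "(y, z) \<in> adjacency ?C" unfolding adjacency_def by blast
    with step.IH show ?case by (rule rtrancl_into_rtrancl)
  qed simp
  have "(x, u) \<in> (adjacency ?C)\<^sup>*" if "(u, x) \<in> (adjacency G)\<^sup>*" for x
    using symD[OF sym_rtrancl[OF adjacency_sym] reach[OF that]] .
  then have "(x, y) \<in> (adjacency ?C)\<^sup>*" if "x \<in> verts ?C" "y \<in> verts ?C" for x y
  proof (rule rtrancl_trans)
    show "(u, y) \<in> (adjacency ?C)\<^sup>*" using that(2) reach by (simp add: component_at_def)
  qed (use that(1) in \<open>simp add: component_at_def\<close>)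
  moreover have "u \<in> verts ?C" by (simp add: component_at_def)
  ultimately show ?thesis unfolding graph_connected_def by blast
qed

lemma self_in_component_at: "u \<in> verts (component_at G u)"
  by (simp add: component_at_def)

lemma connected_subgraph_le_component_at:
  assumes "multigraph G" "subgraph D G" "graph_connected D" "u \<in> verts D"
  shows "subgraph D (component_at G u)"
proof -
  have sub: "edges D \<subseteq> edges G" "ends D = ends G" "multigraph D"
    using assms(2) by (auto simp: subgraph_def)
  have "u \<in> verts G" using assms by (auto simp: subgraph_def)
  note C = component_at_subgraph[OF assms(1) this]
  have "verts D \<subseteq> verts (component_at G u)"
  proof (rule connected_subset[OF assms(3,4) self_in_component_at])
    fix e assume "e \<in> edges D" "ends D e \<inter> verts (component_at G u) \<noteq> {}"
    then show "ends D e \<subseteq> verts (component_at G u)"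
      using component_at_closed[OF assms(1)] sub by (force simp: component_at_def)
  qed
  moreover from this have "edges D \<subseteq> edges (component_at G u)"
    using sub by (auto simp: component_at_def multigraph_def)
  ultimately show ?thesis using sub by (simp add: subgraph_def component_at_def)
qed

lemma component_iff:
  assumes "multigraph G"
  shows "component D G \<and> u \<in> verts D \<longleftrightarrow> u \<in> verts G \<and> D = component_at G u"
proof -
  have *: "component D G \<Longrightarrow> u \<in> verts D \<Longrightarrow> u \<in> verts G \<and> D = component_at G u" for D
    using connected_subgraph_le_component_at[OF assms, of D u] component_at_subgraph[OF assms, of u]
      component_at_connected[OF assms, of u] unfolding component_def subgraph_def by (metis subsetD)
  have "component (component_at G u) G" if u: "u \<in> verts G"
    unfolding component_def
  proof (intro conjI allI impI)
    let ?C = "component_at G u"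
    show "subgraph ?C G" "graph_connected ?C"
      using component_at_subgraph[OF assms u] component_at_connected[OF assms u] by auto
    fix D' assume D': "subgraph D' G \<and> graph_connected D' \<and> subgraph ?C D'"
    then have "u \<in> verts D'" using self_in_component_at[of u G] by (auto simp: subgraph_def)
    then have "subgraph D' ?C" using connected_subgraph_le_component_at[OF assms] D' by blast
    then show "D' = ?C" using D' by (auto simp: subgraph_def intro!: mgraph.equality)
  qed
  then show ?thesis using * self_in_component_at by metis
qed

section \<open>Even edge sets and cycle double covers\<close>

lemma cycle_edges_at:
  assumes "subgraph C G" "cycle_graph C" "v \<in> verts C"
  shows "card {e \<in> edges C. v \<in> ends G e} = 2"
  using assms by (auto simp: cycle_graph_def vdegree_def subgraph_def)

lemma cycle_through_edge:
  assumes G: "multigraph G" and A: "A \<subseteq> edges G"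
    and deg: "\<And>v. v \<in> verts G \<Longrightarrow> card {e \<in> A. v \<in> ends G e} \<in> {0, 2}"
    and e: "e \<in> A"
  shows "\<exists>C. subgraph C G \<and> cycle_graph C \<and> edges C \<subseteq> A \<and> e \<in> edges C"
proof -
  let ?GA = "G\<lparr>edges := A\<rparr>"
  have finA: "finite A" using A G finite_subset by (auto simp: multigraph_def)
  then have GA: "multigraph ?GA" using G A by (auto simp: multigraph_def)
  obtain u where u: "u \<in> ends G e" using edge_has_end[OF G] A e by blast
  then have uG: "u \<in> verts ?GA" using G A e by (auto simp: multigraph_def)
  let ?C = "component_at ?GA u"
  note sub = component_at_subgraph[OF GA uG] and conn = component_at_connected[OF GA uG]
  have ends_C: "ends ?C = ends G" by (simp add: component_at_def)
  have eC: "e \<in> edges ?C"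
    using component_at_closed[OF GA, of e u] self_in_component_at[of u ?GA] u e by auto
  have "vdegree v ?C = 2" if v: "v \<in> verts ?C" for v
  proof -
    have "{e \<in> edges ?C. v \<in> ends G e} = {e \<in> A. v \<in> ends G e}"
      using component_at_closed[OF GA, of _ u] sub v by (auto simp: subgraph_def)
    moreover have "{e \<in> A. v \<in> ends G e} \<noteq> {}"
    proof -
      have "(u, v) \<in> (adjacency ?GA)\<^sup>*" using v by (simp add: component_at_def)
      then show ?thesis
        by (cases rule: rtranclE) (use u e in \<open>auto simp: adjacency_def\<close>)
    qed
    moreover have "v \<in> verts G" using v sub by (auto simp: subgraph_def)
    ultimately show ?thesis using deg[of v] finA by (auto simp: vdegree_def ends_C)
  qed
  then have "cycle_graph ?C" using sub conn by (simp add: cycle_graph_def subgraph_def)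
  moreover have "subgraph ?C G" "edges ?C \<subseteq> A" using sub A by (auto simp: subgraph_def)
  ultimately show ?thesis using eC by blast
qed

text \<open>
  A cycle uses up both edges of \<open>A\<close> at each of its vertices, so it is closed under the edges of \<open>A\<close>
  and swallows every connected part of \<open>A\<close> that it meets.
\<close>

lemma cycle_in_two_regular_le:
  assumes A: "finite A" "\<And>v. v \<in> verts G \<Longrightarrow> card {e \<in> A. v \<in> ends G e} \<le> 2"
    and C: "subgraph C G" "cycle_graph C" "edges C \<subseteq> A"
    and C': "subgraph C' G" "cycle_graph C'" "edges C' \<subseteq> A"
    and e: "e \<in> edges C" "e \<in> edges C'"
  shows "verts C \<subseteq> verts C' \<and> edges C \<subseteq> edges C'"
proof -
  have sub: "ends C = ends G" "ends C' = ends G" "multigraph C" "multigraph C'" "graph_connected C"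
    using C C' by (auto simp: subgraph_def cycle_graph_def)
  have full: "f \<in> edges C'" if f: "f \<in> A" "v \<in> ends G f" "v \<in> verts C'" for f v
  proof -
    have "{e \<in> edges C'. v \<in> ends G e} \<subseteq> {e \<in> A. v \<in> ends G e}" using C' by auto
    moreover have "v \<in> verts G" using C'(1) f(3) by (auto simp: subgraph_def)
    ultimately have "{e \<in> edges C'. v \<in> ends G e} = {e \<in> A. v \<in> ends G e}"
      using A cycle_edges_at[OF C'(1,2) f(3)] by (intro card_seteq) auto
    then show ?thesis using f by blast
  qed
  obtain u where u: "u \<in> verts C" "u \<in> verts C'"
    using edge_has_end[OF sub(3) e(1)] sub e(2) by (metis multigraph_def subsetD)
  have "verts C \<subseteq> verts C'"
  proof (rule connected_subset[OF sub(5) u])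
    fix f assume "f \<in> edges C" "ends C f \<inter> verts C' \<noteq> {}"
    then have "f \<in> edges C'" using full C(3) sub by auto
    then show "ends C f \<subseteq> verts C'" using sub by (auto simp: multigraph_def)
  qed
  moreover have "f \<in> edges C'" if f: "f \<in> edges C" for f
  proof -
    obtain v where "v \<in> ends G f" "v \<in> verts C" using edge_has_end[OF sub(3) f] sub by metis
    then show ?thesis using full f C(3) calculation by blast
  qed
  ultimately show ?thesis by blast
qed

lemma cycle_in_two_regular_unique:
  assumes "finite A" "\<And>v. v \<in> verts G \<Longrightarrow> card {e \<in> A. v \<in> ends G e} \<le> 2"
    and "subgraph C G" "cycle_graph C" "edges C \<subseteq> A"
    and "subgraph C' G" "cycle_graph C'" "edges C' \<subseteq> A"
    and "e \<in> edges C" "e \<in> edges C'"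
  shows "C = C'"
  using cycle_in_two_regular_le[OF assms] cycle_in_two_regular_le[OF assms(1,2,6-8,3-5,10,9)]
    assms(3,6) by (auto simp: subgraph_def intro!: mgraph.equality)

text \<open>
  In a cubic graph, edge sets of even degrees are disjoint unions of cycles. What needs an argument is
  that no cycle arises from two of the sets, since the cover is a set of cycles and not a family.
  Suppose that a cycle \<open>C\<close> does, and let \<open>f\<close> be the edge outside \<open>C\<close> at a vertex \<open>v\<close> of \<open>C\<close>. A set
  \<open>A l\<close> that contains \<open>f\<close> contains one more edge at \<open>v\<close>. This edge lies on \<open>C\<close>, and both sets covering
  it contain \<open>C\<close>; so \<open>A l\<close> contains all three edges at \<open>v\<close>, which is an odd number.
\<close>

theorem k_cycle_double_cover_of_even_edge_sets:
  fixes G :: "('v, 'e) mgraph" and A :: "nat \<Rightarrow> 'e set"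
  assumes G: "multigraph G" "cubic G"
    and A: "\<And>i. i < k \<Longrightarrow> A i \<subseteq> edges G"
    and ev: "\<And>i v. i < k \<Longrightarrow> v \<in> verts G \<Longrightarrow> even (card {e \<in> A i. v \<in> ends G e})"
    and two: "\<And>e. e \<in> edges G \<Longrightarrow> card {i \<in> {..<k}. e \<in> A i} = 2"
  shows "\<exists>S. k_cycle_double_cover k G S"
proof -
  have finG: "finite (edges G)" using G by (simp add: multigraph_def)
  have finA: "finite (A i)" if "i < k" for i using A[OF that] finG finite_subset by blast
  have deg3: "card {e \<in> edges G. v \<in> ends G e} = 3" if "v \<in> verts G" for v
    using G(2) that by (simp add: cubic_def vdegree_def)
  have deg: "card {e \<in> A i. v \<in> ends G e} \<in> {0, 2}" if "i < k" "v \<in> verts G" for i v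
  proof -
    have "card {e \<in> A i. v \<in> ends G e} \<le> card {e \<in> edges G. v \<in> ends G e}"
      using A[OF that(1)] finG by (intro card_mono) auto
    then have "card {e \<in> A i. v \<in> ends G e} \<le> 3" using deg3[OF that(2)] by simp
    moreover have "n \<le> 3 \<Longrightarrow> even n \<Longrightarrow> n = 0 \<or> n = 2" for n :: nat by presburger
    ultimately show ?thesis using ev[OF that] by simp
  qed
  then have deg_le: "card {e \<in> A i. v \<in> ends G e} \<le> 2" if "i < k" "v \<in> verts G" for i v
    using that by fastforce
  define P where "P i = {C. subgraph C G \<and> cycle_graph C \<and> edges C \<subseteq> A i}" for i
  have uniq: "C = C'" if "i < k" "C \<in> P i" "C' \<in> P i" "e \<in> edges C" "e \<in> edges C'" for i C C' e
    using that cycle_in_two_regular_unique[OF finA deg_le] by (auto simp: P_def)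
  have disj: "P i \<inter> P j = {}" if ij: "i < k" "j < k" "i \<noteq> j" for i j
  proof (rule ccontr)
    assume "P i \<inter> P j \<noteq> {}"
    then obtain C where C: "subgraph C G" "cycle_graph C" "edges C \<subseteq> A i" "edges C \<subseteq> A j"
      by (auto simp: P_def)
    then obtain v where v: "v \<in> verts C" by (auto simp: cycle_graph_def graph_connected_def)
    then have vG: "v \<in> verts G" using C by (auto simp: subgraph_def)
    let ?G = "{e \<in> edges G. v \<in> ends G e}" and ?C = "{e \<in> edges C. v \<in> ends G e}"
    have cC: "card ?C = 2" using cycle_edges_at[OF C(1,2) v] .
    have "?C \<subseteq> ?G" using C by (auto simp: subgraph_def)
    moreover have "?C \<noteq> ?G" using cC deg3[OF vG] by auto
    ultimately obtain f where f: "f \<in> edges G" "v \<in> ends G f" "f \<notin> edges C" by blast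
    have "{l \<in> {..<k}. f \<in> A l} \<noteq> {}" using two[OF f(1)] by (metis card.empty zero_neq_numeral)
    then obtain l where l: "l < k" "f \<in> A l" by blast
    have "\<exists>e\<in>?C. e \<in> A l"
    proof (rule ccontr)
      assume no: "\<not> (\<exists>e\<in>?C. e \<in> A l)"
      have "card ({e \<in> A l. v \<in> ends G e} \<union> ?C) \<le> card ?G"
        using A[OF l(1)] \<open>?C \<subseteq> ?G\<close> finG by (intro card_mono) auto
      moreover have "card ({e \<in> A l. v \<in> ends G e} \<union> ?C) = card {e \<in> A l. v \<in> ends G e} + card ?C"
        using no finA[OF l(1)] cC by (intro card_Un_disjoint) (auto simp: card_ge_0_finite)
      moreover have "card {e \<in> A l. v \<in> ends G e} \<noteq> 0" using f l finA by auto
      ultimately show False using deg[OF l(1) vG] cC deg3[OF vG] by simp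
    qed
    then obtain e where e: "e \<in> ?C" "e \<in> A l" by blast
    have "l \<in> {i, j}"
    proof (rule ccontr)
      assume "l \<notin> {i, j}"
      then have "card {i, j, l} = 3" using ij by simp
      moreover have "card {i, j, l} \<le> card {i \<in> {..<k}. e \<in> A i}"
        using ij l e C by (intro card_mono) auto
      moreover have "e \<in> edges G" using e \<open>?C \<subseteq> ?G\<close> by auto
      ultimately show False using two[of e] by simp
    qed
    then have "insert f ?C \<subseteq> {e \<in> A l. v \<in> ends G e}" using C f l by auto
    then have "card (insert f ?C) \<le> card {e \<in> A l. v \<in> ends G e}"
      using finA[OF l(1)] by (intro card_mono) auto
    moreover have "card (insert f ?C) = 3" using cC f by (simp add: card_ge_0_finite)
    ultimately show False using deg_le[OF l(1) vG] by simp
  qed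
  define S where "S = (\<Union>i<k. P i)"
  have "card {C \<in> S. e \<in> edges C} = 2" if e: "e \<in> edges G" for e
  proof -
    let ?I = "{i \<in> {..<k}. e \<in> A i}"
    have "\<forall>i\<in>?I. \<exists>C. C \<in> P i \<and> e \<in> edges C"
      using cycle_through_edge[OF G(1) A deg] by (fastforce simp: P_def)
    then obtain cyc where cyc: "\<And>i. i \<in> ?I \<Longrightarrow> cyc i \<in> P i \<and> e \<in> edges (cyc i)" by metis
    have "{C \<in> S. e \<in> edges C} = cyc ` ?I"
    proof
      show "cyc ` ?I \<subseteq> {C \<in> S. e \<in> edges C}" using cyc by (auto simp: S_def)
      show "{C \<in> S. e \<in> edges C} \<subseteq> cyc ` ?I"
      proof
        fix C assume "C \<in> {C \<in> S. e \<in> edges C}"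
        then obtain i where i: "i < k" "C \<in> P i" "e \<in> edges C" by (auto simp: S_def)
        then have "i \<in> ?I" by (auto simp: P_def)
        then show "C \<in> cyc ` ?I" using uniq[OF i(1,2) _ i(3)] cyc by blast
      qed
    qed
    moreover have "inj_on cyc ?I"
    proof (rule inj_onI)
      fix i j assume ij: "i \<in> ?I" "j \<in> ?I" "cyc i = cyc j"
      then have "cyc i \<in> P i \<inter> P j" using cyc by fastforce
      then show "i = j" using disj[of i j] ij by auto
    qed
    ultimately show ?thesis using two[OF e] by (simp add: card_image)
  qed
  then have "cycle_double_cover G S"
    by (auto simp: cycle_double_cover_def S_def P_def)
  moreover have "edges C \<inter> edges C' = {}" if "i < k" "C \<in> P i" "C' \<in> P i" "C \<noteq> C'" for i C C'
    using uniq[OF that(1-3)] that(4) by blast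
  ultimately show ?thesis
    unfolding k_cycle_double_cover_def
    by (intro exI[of _ S] conjI exI[of _ P] allI impI ballI) (simp_all add: S_def disj)
qed

section \<open>Colourings of frame components\<close>

lemma card_incident_eq_half_degree:
  assumes "finite J" "\<And>e. e \<in> J \<Longrightarrow> ends G e = {p e, q e} \<and> p e \<noteq> q e"
  shows "card {e \<in> J. v \<in> ends G e} = half_degree p q J v"
proof -
  have "{e \<in> J. v \<in> ends G e} = {e \<in> J. p e = v} \<union> {e \<in> J. q e = v}" using assms(2) by auto
  moreover have "{e \<in> J. p e = v} \<inter> {e \<in> J. q e = v} = {}" using assms(2) by fastforce
  ultimately show ?thesis using assms(1) by (simp add: half_degree_def card_Un_disjoint)
qed

lemma cubic_even_order:
  assumes "multigraph G" "cubic G"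
  shows "even (card (verts G))"
proof -
  have fin: "finite (verts G)" "finite (edges G)" using assms(1) by (auto simp: multigraph_def)
  obtain p q where pq: "\<And>e. e \<in> edges G \<Longrightarrow> ends G e = {p e, q e} \<and> p e \<noteq> q e"
    using ends_eq_pair[OF assms(1)] by blast
  have "edge_closed p q (edges G) (verts G)"
    using assms(1) pq unfolding edge_closed_def multigraph_def by blast
  then have "even (\<Sum>v\<in>verts G. half_degree p q (edges G) v)"
    using fin by (intro even_sum_half_degree_closed) auto
  also have "(\<Sum>v\<in>verts G. half_degree p q (edges G) v) = (\<Sum>v\<in>verts G. 3)"
    using assms(2) card_incident_eq_half_degree[OF fin(2) pq]
    by (intro sum.cong) (auto simp: cubic_def vdegree_def)
  finally show ?thesis by simp
qed

definition edge_saturated :: "('v, 'e) mgraph \<Rightarrow> 'e set \<Rightarrow> 'v set \<Rightarrow> bool" where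
  "edge_saturated D J Z \<longleftrightarrow> (\<forall>e\<in>J. ends D e \<subseteq> Z \<or> ends D e \<inter> Z = {})"

lemma connected_saturated:
  assumes "graph_connected D" "edge_saturated D (edges D) Z" "u \<in> verts D" "v \<in> verts D"
  shows "u \<in> Z \<longleftrightarrow> v \<in> Z"
proof -
  have "v \<in> Z" if "u \<in> Z" "u \<in> verts D" "v \<in> verts D" for u v
    using connected_subset[OF assms(1) that(2,1)] assms(2) that(3)
    by (auto simp: edge_saturated_def)
  then show ?thesis using assms(3,4) by blast
qed

text \<open>
  What the proof needs to know about a component \<open>D\<close> of the frame, be it a cycle or a subdivided
  Kotzig graph. The vertices of degree 2 are called free: in the cubic host graph they are the ends of
  the edges outside the frame. Deleting the edges of one colour \<open>h\<close> leaves a subgraph with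
  all degrees 0 or 2, and the last clause says that this subgraph links all free vertices that it
  covers. Stating this with saturated sets \<open>Z\<close> avoids speaking of the deleted graph.
\<close>

definition tricolored :: "('v, 'e) mgraph \<Rightarrow> ('v \<Rightarrow> nat) \<Rightarrow> ('e \<Rightarrow> nat) \<Rightarrow> bool" where
  "tricolored D vc ec \<longleftrightarrow>
     even (card {v \<in> verts D. vdegree v D = 2}) \<and>
     (\<forall>v\<in>verts D.
        vdegree v D = 3 \<and> ec ` {e \<in> edges D. v \<in> ends D e} = {1, 2, 3} \<or>
        vdegree v D = 2 \<and> vc v \<in> {1, 2, 3} \<and> ec ` {e \<in> edges D. v \<in> ends D e} = {vc v}) \<and>
     (\<forall>h\<in>{1, 2, 3}. \<forall>Z. edge_saturated D {e \<in> edges D. ec e \<noteq> h} Z \<longrightarrow>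
        (\<forall>u\<in>verts D. \<forall>v\<in>verts D. vdegree u D = 2 \<and> vdegree v D = 2 \<and> vc u \<noteq> h \<and> vc v \<noteq> h \<longrightarrow>
           (u \<in> Z \<longleftrightarrow> v \<in> Z)))"

lemma tricolored_cycle:
  assumes "cycle_graph D" "even (card (verts D))" "g \<in> {1, 2, 3}"
  shows "tricolored D (\<lambda>_. g) (\<lambda>_. g)"
proof -
  have deg: "vdegree v D = 2" if "v \<in> verts D" for v
    using assms(1) that by (simp add: cycle_graph_def)
  then have "{v \<in> verts D. vdegree v D = 2} = verts D" by auto
  moreover have "(\<lambda>_. g) ` {e \<in> edges D. v \<in> ends D e} = {g}" if "v \<in> verts D" for v
  proof -
    have "{e \<in> edges D. v \<in> ends D e} \<noteq> {}"
      using deg[OF that] unfolding vdegree_def by (metis card.empty zero_neq_numeral)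
    then show ?thesis by auto
  qed
  moreover have saturated: "u \<in> Z \<longleftrightarrow> v \<in> Z"
    if "edge_saturated D (edges D) Z" "u \<in> verts D" "v \<in> verts D" for u v Z
    using connected_saturated[OF _ that] assms(1) by (simp add: cycle_graph_def)
  ultimately show ?thesis
    unfolding tricolored_def
  proof (intro conjI ballI allI impI)
    fix h Z u v
    assume *: "edge_saturated D {e \<in> edges D. g \<noteq> h} Z" "u \<in> verts D" "v \<in> verts D"
      "vdegree u D = 2 \<and> vdegree v D = 2 \<and> g \<noteq> h \<and> g \<noteq> h"
    then have "edge_saturated D (edges D) Z" by simp
    then show "u \<in> Z \<longleftrightarrow> v \<in> Z" using saturated *(2,3) by blast
  qed (use assms(2,3) deg in auto)
qed

lemma tricolored_transpose:
  assumes "tricolored D vc ec" "a \<in> {1, 2, 3}" "b \<in> {1, 2, 3}"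
  shows "tricolored D (transpose a b \<circ> vc) (transpose a b \<circ> ec)"
proof -
  let ?t = "transpose a b"
  have range: "?t h \<in> {1, 2, 3}" if "h \<in> {1, 2, 3}" for h
    using assms(2,3) that by (auto simp: transpose_def)
  have range': "?t ` {1, 2, 3} = {1, 2, 3}"
  proof
    show "{1, 2, 3} \<subseteq> ?t ` {1, 2, 3}"
    proof
      fix x :: nat assume "x \<in> {1, 2, 3}"
      then show "x \<in> ?t ` {1, 2, 3}"
        using range[of x] transpose_involutory[of a b x] by (metis imageI)
    qed
  qed (use range in \<open>rule image_subsetI\<close>)
  have flip: "?t x \<noteq> h \<longleftrightarrow> x \<noteq> ?t h" for x h
    by (metis transpose_involutory)
  show ?thesis
    unfolding tricolored_def
  proof (intro conjI ballI allI impI)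
    show "even (card {v \<in> verts D. vdegree v D = 2})" using assms(1) by (simp add: tricolored_def)
    fix v assume "v \<in> verts D"
    then consider
      "vdegree v D = 3" "ec ` {e \<in> edges D. v \<in> ends D e} = {1, 2, 3}" |
      "vdegree v D = 2" "vc v \<in> {1, 2, 3}" "ec ` {e \<in> edges D. v \<in> ends D e} = {vc v}"
      using assms(1) unfolding tricolored_def by blast
    then show "vdegree v D = 3 \<and> (?t \<circ> ec) ` {e \<in> edges D. v \<in> ends D e} = {1, 2, 3} \<or>
        vdegree v D = 2 \<and> (?t \<circ> vc) v \<in> {1, 2, 3} \<and>
        (?t \<circ> ec) ` {e \<in> edges D. v \<in> ends D e} = {(?t \<circ> vc) v}"
    proof cases
      case 1 then show ?thesis using range' by (simp only: image_comp[symmetric] simp_thms)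
    next
      case 2 then show ?thesis using range[of "vc v"]
        by (simp only: image_comp[symmetric] simp_thms comp_apply image_insert image_empty)
    qed
  next
    fix h Z u v
    assume h: "h \<in> {1, 2, 3}" and Z: "edge_saturated D {e \<in> edges D. (?t \<circ> ec) e \<noteq> h} Z"
      and uv: "u \<in> verts D" "v \<in> verts D"
        "vdegree u D = 2 \<and> vdegree v D = 2 \<and> (?t \<circ> vc) u \<noteq> h \<and> (?t \<circ> vc) v \<noteq> h"
    have "edge_saturated D {e \<in> edges D. ec e \<noteq> ?t h} Z" using Z by (simp add: flip)
    moreover have "vc u \<noteq> ?t h" "vc v \<noteq> ?t h" using uv(3) by (auto simp: flip)
    ultimately show "u \<in> Z \<longleftrightarrow> v \<in> Z"
      using assms(1) range[OF h] uv unfolding tricolored_def by blast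
  qed
qed

section \<open>Subdivisions of Kotzig graphs\<close>

lemma path_graph_saturated:
  assumes "path_graph v w Q" "edge_saturated Q (edges Q) Z" "x \<in> verts Q" "y \<in> verts Q"
  shows "x \<in> Z \<longleftrightarrow> y \<in> Z"
proof -
  obtain vs es where Q: "length vs = Suc (length es)" "verts Q = set vs" "edges Q = set es"
      "\<And>i. i < length es \<Longrightarrow> ends Q (es ! i) = {vs ! i, vs ! Suc i}"
    using assms(1) by (auto simp: path_graph_def)
  have "vs ! i \<in> Z \<longleftrightarrow> vs ! 0 \<in> Z" if "i < length vs" for i
    using that
  proof (induction i)
    case (Suc i)
    then have "i < length es" using Q(1) by simp
    then have "vs ! i \<in> Z \<longleftrightarrow> vs ! Suc i \<in> Z"
      using Q(3) Q(4)[of i] assms(2) by (fastforce simp: edge_saturated_def)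
    then show ?case using Suc by simp
  qed simp
  then show ?thesis using assms(3,4) Q(2) by (metis in_set_conv_nth)
qed

lemma path_graph_end_edge:
  assumes "path_graph v w Q" "v \<noteq> w" "x \<in> {v, w}"
  obtains e where "e \<in> edges Q" "x \<in> ends Q e"
proof -
  obtain vs es where Q: "length vs = Suc (length es)" "hd vs = v" "last vs = w" "edges Q = set es"
      "\<And>i. i < length es \<Longrightarrow> ends Q (es ! i) = {vs ! i, vs ! Suc i}"
    using assms(1) by (auto simp: path_graph_def)
  have "vs \<noteq> []" using Q(1) by auto
  then have hl: "vs ! 0 = v" "vs ! length es = w"
    using Q(1-3) by (auto simp: hd_conv_nth last_conv_nth)
  then have n: "0 < length es" using assms(2) by (cases "length es") auto
  then have "v \<in> ends Q (es ! 0)" "w \<in> ends Q (es ! (length es - 1))"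
    using Q(5)[of 0] Q(5)[of "length es - 1"] hl by auto
  moreover have "es ! 0 \<in> edges Q" "es ! (length es - 1) \<in> edges Q" using Q(4) n by auto
  ultimately show ?thesis using assms(3) that by blast
qed

lemma path_graph_internal_degree:
  assumes "path_graph v w Q" "x \<in> verts Q" "x \<noteq> v" "x \<noteq> w"
  shows "card {e \<in> edges Q. x \<in> ends Q e} = 2"
proof -
  obtain vs es where Q: "distinct vs" "length vs = Suc (length es)" "hd vs = v" "last vs = w"
      "verts Q = set vs" "edges Q = set es"
      "\<And>i. i < length es \<Longrightarrow> ends Q (es ! i) = {vs ! i, vs ! Suc i}"
    using assms(1) by (auto simp: path_graph_def)
  obtain i where i: "i < length vs" "x = vs ! i" using assms(2) Q(5) by (metis in_set_conv_nth)
  have "vs \<noteq> []" using Q(2) by auto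
  then have "vs ! 0 = v" "vs ! length es = w"
    using Q(2-4) by (auto simp: hd_conv_nth last_conv_nth)
  then have "i \<noteq> 0" "i \<noteq> length es" using i(2) assms(3,4) by metis+
  then obtain k where k: "i = Suc k" "Suc k < length es" using i(1) Q(2) by (cases i) auto
  have at_x: "x \<in> ends Q (es ! j) \<longleftrightarrow> j = k \<or> j = Suc k" if "j < length es" for j
    using that k i(2) Q(1,2,7) by (auto simp: nth_eq_iff_index_eq)
  have "{e \<in> edges Q. x \<in> ends Q e} = {es ! k, es ! Suc k}"
  proof
    show "{e \<in> edges Q. x \<in> ends Q e} \<subseteq> {es ! k, es ! Suc k}"
      using at_x Q(6) by (auto simp: in_set_conv_nth)
    show "{es ! k, es ! Suc k} \<subseteq> {e \<in> edges Q. x \<in> ends Q e}"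
      using at_x[of k] at_x[of "Suc k"] k(2) Q(6) by simp
  qed
  moreover have "es ! k \<noteq> es ! Suc k"
  proof
    assume "es ! k = es ! Suc k"
    then have "vs ! k \<in> {vs ! Suc k, vs ! Suc (Suc k)}" using Q(7)[of k] Q(7)[of "Suc k"] k by auto
    then show False using Q(1,2) k by (auto simp: nth_eq_iff_index_eq)
  qed
  ultimately show ?thesis by simp
qed

lemma subdivision_path:
  assumes "subdivision D K P" "e \<in> edges K"
  obtains v w where "ends K e = {v, w}" "v \<noteq> w" "path_graph v w (P e)"
    "verts (P e) \<inter> verts K = {v, w}" "ends (P e) = ends D" "edges (P e) \<subseteq> edges D"
proof -
  have "multigraph K" and "\<forall>e\<in>edges K. subgraph (P e) D \<and>
      (\<exists>v w. ends K e = {v, w} \<and> path_graph v w (P e)) \<and> verts (P e) \<inter> verts K = ends K e"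
    using assms(1) by (simp_all add: subdivision_def)
  then obtain v w where vw: "subgraph (P e) D" "ends K e = {v, w}" "path_graph v w (P e)"
      "verts (P e) \<inter> verts K = {v, w}" "card (ends K e) = 2"
    using assms(2) unfolding multigraph_def by metis
  then have "v \<noteq> w" by auto
  then show ?thesis using that vw by (simp add: subgraph_def)
qed

lemma subdivision_edge:
  assumes "subdivision D K P" "f \<in> edges D"
  obtains e where "e \<in> edges K" "f \<in> edges (P e)"
proof -
  have "edges D = (\<Union>e\<in>edges K. edges (P e))" using assms(1) unfolding subdivision_def by blast
  then show ?thesis using assms(2) that by blast
qed

lemma subdivision_internal_vertex:
  assumes "subdivision D K P" "x \<in> verts D" "x \<notin> verts K"
  obtains e where "e \<in> edges K" "x \<in> verts (P e)"
    "{f \<in> edges D. x \<in> ends D f} \<subseteq> edges (P e)" "vdegree x D = 2"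
proof -
  obtain e where e: "e \<in> edges K" "x \<in> verts (P e)"
    using assms by (auto simp: subdivision_def)
  obtain v w where P: "path_graph v w (P e)" "verts (P e) \<inter> verts K = {v, w}"
      "ends (P e) = ends D" "edges (P e) \<subseteq> edges D"
    using subdivision_path[OF assms(1) e(1)] by metis
  have "f \<in> edges (P e)" if f: "f \<in> edges D" "x \<in> ends D f" for f
  proof -
    obtain g where g: "g \<in> edges K" "f \<in> edges (P g)"
      using subdivision_edge[OF assms(1) f(1)] .
    have "subgraph (P g) D" using assms(1) g by (auto simp: subdivision_def)
    then have "ends D f \<subseteq> verts (P g)" using g(2) unfolding subgraph_def multigraph_def by metis
    then have "x \<in> verts (P g)" using f(2) by blast
    then have "g = e" using assms(1,3) e g unfolding subdivision_def by blast
    then show ?thesis using g by simp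
  qed
  then have sub: "{f \<in> edges D. x \<in> ends D f} \<subseteq> edges (P e)" by blast
  then have "{f \<in> edges D. x \<in> ends D f} = {f \<in> edges (P e). x \<in> ends (P e) f}"
    using P(3,4) by auto
  moreover have "x \<noteq> v" "x \<noteq> w" using P(2) assms(3) by auto
  ultimately have "vdegree x D = 2"
    using path_graph_internal_degree[OF P(1) e(2)] by (simp add: vdegree_def)
  then show ?thesis using that e sub by blast
qed

lemma proper_cubic_colors_at:
  assumes "multigraph K" "cubic K" "proper_3_edge_coloring K c" "x \<in> verts K"
  shows "inj_on c {e \<in> edges K. x \<in> ends K e}" "c ` {e \<in> edges K. x \<in> ends K e} = {1, 2, 3}"
proof -
  let ?I = "{e \<in> edges K. x \<in> ends K e}"
  show inj: "inj_on c ?I"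
    using assms(3) unfolding proper_3_edge_coloring_def inj_on_def by blast
  have "card ?I = 3" using assms(2,4) by (simp add: cubic_def vdegree_def)
  then have "card (c ` ?I) = card {1, 2, 3::nat}" using inj by (simp add: card_image)
  moreover have "c ` ?I \<subseteq> {1, 2, 3}" using assms(3) by (auto simp: proper_3_edge_coloring_def)
  ultimately show "c ` ?I = {1, 2, 3}" by (intro card_subset_eq) auto
qed

text \<open>
  Two colours of a proper 3-edge-coloring of a cubic graph form a 2-regular graph. A cycle in it is
  bicolored, hence hamiltonian, hence connects all vertices.
\<close>

lemma kotzig_two_colors_connected:
  assumes K: "multigraph K" "cubic K" "kotzig_coloring K c" and h: "h \<in> {1, 2, 3}"
    and Z: "edge_saturated K {e \<in> edges K. c e \<noteq> h} Z" and uv: "u \<in> verts K" "v \<in> verts K"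
  shows "u \<in> Z \<longleftrightarrow> v \<in> Z"
proof -
  have proper: "proper_3_edge_coloring K c" using K(3) by (simp add: kotzig_coloring_def)
  let ?A = "{e \<in> edges K. c e \<noteq> h}"
  have deg: "card {e \<in> ?A. x \<in> ends K e} = 2" if x: "x \<in> verts K" for x
  proof -
    note cols = proper_cubic_colors_at[OF K(1,2) proper x]
    have "c ` {e \<in> ?A. x \<in> ends K e} = c ` {e \<in> edges K. x \<in> ends K e} - {h}" by auto
    then have "card (c ` {e \<in> ?A. x \<in> ends K e}) = 2" using cols(2) h by auto
    moreover have "inj_on c {e \<in> ?A. x \<in> ends K e}"
      using cols(1) by (rule inj_on_subset) auto
    ultimately show ?thesis by (simp add: card_image)
  qed
  have "{e \<in> ?A. u \<in> ends K e} \<noteq> {}" using deg[OF uv(1)] by (metis card.empty zero_neq_numeral)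
  then obtain e where e: "e \<in> ?A" by blast
  obtain C where C: "subgraph C K" "cycle_graph C" "edges C \<subseteq> ?A"
    using cycle_through_edge[OF K(1) _ _ e] deg by blast
  have "c ` edges C \<subseteq> {1, 2, 3} - {h}"
    using C(3) proper by (auto simp: proper_3_edge_coloring_def)
  then have "card (c ` edges C) \<le> card ({1, 2, 3} - {h})" by (intro card_mono) auto
  then have "bicolored c C" using h by (auto simp: bicolored_def)
  then have "verts C = verts K" using K(3) C by (auto simp: kotzig_coloring_def)
  moreover have "edge_saturated C (edges C) Z"
    using Z C by (auto simp: edge_saturated_def subgraph_def)
  ultimately show ?thesis
    using connected_saturated[of C Z u v] C(2) uv by (simp add: cycle_graph_def)
qed

text \<open>
  The colours of \<open>K\<close> are constant along the subdividing paths. So a saturated set either contains or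
  avoids a whole path, which carries the linking property of two colours from \<open>K\<close> to \<open>D\<close>. The free
  vertices are the subdivision vertices, and there is an even number of them because \<open>D\<close> has even
  order and so does the cubic graph \<open>K\<close>.
\<close>

lemma tricolored_kotzig_subdivision:
  assumes D: "subdivision D K P" "even (card (verts D))"
    and deg3: "\<And>v. v \<in> verts D \<Longrightarrow> vdegree v D \<le> 3"
    and K: "kotzig_graph K" "kotzig_coloring K c"
    and ec: "\<And>e f. e \<in> edges K \<Longrightarrow> f \<in> edges (P e) \<Longrightarrow> ec f = c e"
    and vc: "\<And>v e. v \<in> verts D \<Longrightarrow> vdegree v D = 2 \<Longrightarrow> e \<in> edges D \<Longrightarrow> v \<in> ends D e \<Longrightarrow> vc v = ec e"
  shows "tricolored D vc ec"
proof -
  have K': "multigraph K" "cubic K" using K(1) by (auto simp: kotzig_graph_def)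
  have proper: "proper_3_edge_coloring K c" using K(2) by (simp add: kotzig_coloring_def)
  have finD: "finite (verts D)" "finite (edges D)" and KD: "verts K \<subseteq> verts D"
    using D(1) by (auto simp: subdivision_def multigraph_def)
  have ec_range: "ec f \<in> {1, 2, 3}" if f: "f \<in> edges D" for f
  proof -
    obtain e where "e \<in> edges K" "f \<in> edges (P e)" using subdivision_edge[OF D(1) f] .
    then show ?thesis using ec proper by (auto simp: proper_3_edge_coloring_def)
  qed
  \<comment> \<open>three paths of different colours start at \<open>x\<close>, and the degree bound leaves no room for more\<close>
  have branch: "vdegree x D = 3 \<and> ec ` {f \<in> edges D. x \<in> ends D f} = {1, 2, 3}"
    if x: "x \<in> verts K" for x
  proof -
    let ?I = "{f \<in> edges D. x \<in> ends D f}"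
    have "j \<in> ec ` ?I" if j: "j \<in> {1, 2, 3}" for j
    proof -
      have "j \<in> c ` {e \<in> edges K. x \<in> ends K e}"
        using proper_cubic_colors_at(2)[OF K' proper x] j by simp
      then obtain e where e: "e \<in> edges K" "x \<in> ends K e" "c e = j" by blast
      obtain v w where P: "ends K e = {v, w}" "v \<noteq> w" "path_graph v w (P e)"
          "ends (P e) = ends D" "edges (P e) \<subseteq> edges D"
        using subdivision_path[OF D(1) e(1)] by metis
      obtain f where "f \<in> edges (P e)" "x \<in> ends (P e) f"
        using path_graph_end_edge[OF P(3,2)] e(2) P(1) by metis
      then show ?thesis using ec[OF e(1)] e(3) P(4,5) by force
    qed
    moreover have "ec ` ?I \<subseteq> {1, 2, 3}" using ec_range by auto
    ultimately have img: "ec ` ?I = {1, 2, 3}" by blast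
    then have "card {1, 2, 3::nat} \<le> card ?I" using card_image_le[of ?I ec] finD by simp
    then show ?thesis using img deg3[of x] KD x by (auto simp: vdegree_def)
  qed
  have deg2_iff: "vdegree x D = 2 \<longleftrightarrow> x \<notin> verts K" if "x \<in> verts D" for x
    using branch[of x] subdivision_internal_vertex[OF D(1) that] by fastforce
  then have "{v \<in> verts D. vdegree v D = 2} = verts D - verts K" by auto
  then have "even (card {v \<in> verts D. vdegree v D = 2})"
    using D(2) cubic_even_order[OF K'] KD finD finite_subset[OF KD] card_mono[OF finD(1) KD]
    by (simp add: card_Diff_subset)
  moreover have "vdegree x D = 2 \<and> vc x \<in> {1, 2, 3} \<and> ec ` {f \<in> edges D. x \<in> ends D f} = {vc x}"
    if x: "x \<in> verts D" "x \<notin> verts K" for x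
  proof -
    have d: "vdegree x D = 2" using deg2_iff x by simp
    then have "{f \<in> edges D. x \<in> ends D f} \<noteq> {}"
      unfolding vdegree_def by (metis card.empty zero_neq_numeral)
    then obtain f where f: "f \<in> edges D" "x \<in> ends D f" by blast
    then have "vc x \<in> {1, 2, 3}" using vc[OF x(1) d f] ec_range by simp
    moreover have "ec ` {f \<in> edges D. x \<in> ends D f} = {vc x}"
    proof -
      have "ec g = vc x" if "g \<in> edges D" "x \<in> ends D g" for g using vc[OF x(1) d that] by simp
      then show ?thesis using f by (auto intro!: rev_image_eqI[of f])
    qed
    ultimately show ?thesis using d by blast
  qed
  moreover have "u \<in> Z \<longleftrightarrow> v \<in> Z"
    if h: "h \<in> {1, 2, 3}" and Z: "edge_saturated D {e \<in> edges D. ec e \<noteq> h} Z"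
      and uv: "u \<in> verts D" "v \<in> verts D" "vdegree u D = 2" "vdegree v D = 2" "vc u \<noteq> h" "vc v \<noteq> h"
    for h Z u v
  proof -
    have path: "x \<in> Z \<longleftrightarrow> y \<in> Z"
      if e: "e \<in> edges K" "c e \<noteq> h" and xy: "x \<in> verts (P e)" "y \<in> verts (P e)" for e x y
    proof -
      obtain v w where P: "path_graph v w (P e)" "ends (P e) = ends D" "edges (P e) \<subseteq> edges D"
        using subdivision_path[OF D(1) e(1)] by metis
      then have "edge_saturated (P e) (edges (P e)) Z"
        using Z ec[OF e(1)] e(2) by (auto simp: edge_saturated_def)
      then show ?thesis using path_graph_saturated[OF P(1) _ xy] by simp
    qed
    have ends_in: "ends K e \<subseteq> verts (P e)" if e: "e \<in> edges K" for e
      by (rule subdivision_path[OF D(1) e]) blast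
    have sat: "edge_saturated K {e \<in> edges K. c e \<noteq> h} Z"
      using path ends_in unfolding edge_saturated_def by blast
    have anchor: "\<exists>y\<in>verts K. x \<in> Z \<longleftrightarrow> y \<in> Z"
      if x: "x \<in> verts D" "vdegree x D = 2" "vc x \<noteq> h" for x
    proof -
      have "x \<notin> verts K" using deg2_iff x by simp
      then obtain e where e: "e \<in> edges K" "x \<in> verts (P e)"
          "{f \<in> edges D. x \<in> ends D f} \<subseteq> edges (P e)"
        using subdivision_internal_vertex[OF D(1) x(1)] by blast
      have "{f \<in> edges D. x \<in> ends D f} \<noteq> {}"
        using x(2) unfolding vdegree_def by (metis card.empty zero_neq_numeral)
      then obtain f where f: "f \<in> edges D" "x \<in> ends D f" by blast
      then have "c e \<noteq> h" using vc[OF x(1,2) f] ec[OF e(1), of f] e(3) x(3) by auto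
      moreover obtain y where "y \<in> ends K e" "y \<in> verts K"
        using edge_has_end[OF K'(1) e(1)] .
      ultimately show ?thesis using path[OF e(1) _ e(2)] ends_in[OF e(1)] by blast
    qed
    obtain y z where "y \<in> verts K" "u \<in> Z \<longleftrightarrow> y \<in> Z" "z \<in> verts K" "v \<in> Z \<longleftrightarrow> z \<in> Z"
      using anchor[OF uv(1,3,5)] anchor[OF uv(2,4,6)] by blast
    then show ?thesis using kotzig_two_colors_connected[OF K' K(2) h sat, of y z] by simp
  qed
  ultimately show ?thesis
    unfolding tricolored_def
  proof (intro conjI ballI allI impI, goal_cases)
    case (2 x)
    then show ?case using branch[of x] by (cases "x \<in> verts K") blast+
  next
    case (3 h Z u v)
    then show ?case by blast
  qed
qed

section \<open>Six even edge sets\<close>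

lemma tricolored_cong:
  assumes "tricolored D vc ec" "\<And>v. v \<in> verts D \<Longrightarrow> vc' v = vc v" "\<And>e. e \<in> edges D \<Longrightarrow> ec' e = ec e"
  shows "tricolored D vc' ec'"
proof -
  have "ec' ` {e \<in> edges D. v \<in> ends D e} = ec ` {e \<in> edges D. v \<in> ends D e}" for v
    using assms(3) by (intro image_cong) auto
  moreover have "{e \<in> edges D. ec' e \<noteq> h} = {e \<in> edges D. ec e \<noteq> h}" for h
    using assms(3) by auto
  ultimately show ?thesis
    using assms(1) unfolding tricolored_def by (simp only: assms(2) cong: ball_cong) blast
qed

lemma component_edges_at:
  assumes "multigraph F" "v \<in> verts F"
  shows "{e \<in> edges (component_at F v). v \<in> ends (component_at F v) e} = {e \<in> edges F. v \<in> ends F e}"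
  using component_at_closed[OF assms(1), of _ v] self_in_component_at[of v F]
  by (auto simp: component_at_def)

lemma connecting_edges_at:
  assumes "multigraph G" "cubic G" "subgraph F G" "v \<in> verts F"
    and "tricolored (component_at F v) vc ec"
  shows "card {e \<in> edges G - edges F. v \<in> ends G e} =
           (if vdegree v (component_at F v) = 2 then 1 else 0)"
proof -
  have F: "multigraph F" "edges F \<subseteq> edges G" "ends F = ends G" "v \<in> verts G"
    using assms(3,4) by (auto simp: subgraph_def)
  have fin: "finite (edges G)" using assms(1) by (simp add: multigraph_def)
  have "{e \<in> edges G - edges F. v \<in> ends G e} =
      {e \<in> edges G. v \<in> ends G e} - {e \<in> edges F. v \<in> ends G e}" by auto
  moreover have "card {e \<in> edges G. v \<in> ends G e} = 3"
    using assms(2) F(4) by (simp add: cubic_def vdegree_def)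
  moreover have "card {e \<in> edges F. v \<in> ends G e} = vdegree v (component_at F v)"
    using component_edges_at[OF F(1) assms(4)] F(3) by (simp add: vdegree_def)
  moreover have "{e \<in> edges F. v \<in> ends G e} \<subseteq> {e \<in> edges G. v \<in> ends G e}" using F(2) by auto
  moreover have "vdegree v (component_at F v) \<in> {2, 3}"
    using assms(5) self_in_component_at[of v F] by (auto simp: tricolored_def)
  ultimately show ?thesis
    using fin finite_subset[OF F(2) fin] by (auto simp: card_Diff_subset)
qed

text \<open>
  For each colour \<open>h\<close>, the frame edges of colour different from \<open>h\<close> form a set \<open>H h\<close> of even degrees,
  and the edges with \<open>\<mu> e = h\<close> form a set \<open>M h\<close> whose ends lie on \<open>H h\<close>. The ends of \<open>M h\<close> in one
  component are linked by \<open>H h\<close> and even in number, so \<open>H h\<close> contains a join \<open>J h\<close> for them. The six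
  sets are \<open>M h \<union> J h\<close> and \<open>M h \<union> (H h - J h)\<close>: an edge outside the frame lies in both sets for
  \<open>h = \<mu> e\<close>, a frame edge in one of the two sets for each of the two colours \<open>h\<close> that it does not have.
\<close>

lemma six_even_edge_sets:
  fixes G F :: "('v, 'e) mgraph"
  assumes G: "multigraph G" "cubic G" and F: "subgraph F G" "verts F = verts G"
    and tri: "\<And>D. component D F \<Longrightarrow> tricolored D vc ec"
    and \<mu>: "\<And>e. e \<in> edges G - edges F \<Longrightarrow> \<mu> e \<in> {1, 2, 3} - vc ` ends G e"
    and par: "\<And>D h. component D F \<Longrightarrow> h \<in> {1, 2, 3} \<Longrightarrow>
      even (\<Sum>v\<in>verts D. card {e \<in> {e \<in> edges G - edges F. \<mu> e = h}. v \<in> ends G e})"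
  shows "\<exists>A :: nat \<Rightarrow> 'e set. (\<forall>i<6. A i \<subseteq> edges G) \<and>
     (\<forall>i<6. \<forall>v\<in>verts G. even (card {e \<in> A i. v \<in> ends G e})) \<and>
     (\<forall>e\<in>edges G. card {i \<in> {..<6}. e \<in> A i} = 2)"
proof -
  have F': "multigraph F" "edges F \<subseteq> edges G" "ends F = ends G" using F by (auto simp: subgraph_def)
  have fin: "finite (verts G)" "finite (edges G)" "finite (edges F)"
    using G(1) F'(1) by (auto simp: multigraph_def)
  obtain p q where pq: "\<And>e. e \<in> edges G \<Longrightarrow> ends G e = {p e, q e} \<and> p e \<noteq> q e"
    using ends_eq_pair[OF G(1)] by blast
  define deg where "deg X v = card {e \<in> X. v \<in> ends G e}" for X v
  have deg_half: "deg X v = half_degree p q X v" if "X \<subseteq> edges G" for X v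
    unfolding deg_def using that finite_subset[OF that fin(2)] pq
    by (intro card_incident_eq_half_degree) auto
  have deg_Un: "deg (X \<union> Y) v = deg X v + deg Y v"
    if "X \<subseteq> edges G" "Y \<subseteq> edges G" "X \<inter> Y = {}" for X Y v
    using that half_degree_Un[of X Y p q v] deg_half finite_subset[OF _ fin(2)] by simp
  have comp: "component (component_at F v) F" if "v \<in> verts G" for v
    using component_iff[OF F'(1)] that F(2) by blast
  have at: "ec ` {e \<in> edges F. v \<in> ends G e} = {1, 2, 3} \<and> card {e \<in> edges F. v \<in> ends G e} = 3 \<or>
      vc v \<in> {1, 2, 3} \<and> ec ` {e \<in> edges F. v \<in> ends G e} = {vc v} \<and>
      card {e \<in> edges F. v \<in> ends G e} = 2 \<and> vdegree v (component_at F v) = 2"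
    if v: "v \<in> verts G" for v
  proof -
    have I: "{e \<in> edges (component_at F v). v \<in> ends (component_at F v) e} =
        {e \<in> edges F. v \<in> ends G e}"
      using component_edges_at[OF F'(1)] v F(2) F'(3) by simp
    then have "vdegree v (component_at F v) = card {e \<in> edges F. v \<in> ends G e}"
      by (simp add: vdegree_def)
    then show ?thesis
      using bspec[OF conjunct1[OF conjunct2[OF tri[OF comp[OF v], unfolded tricolored_def]]]
        self_in_component_at] I by auto
  qed
  define H where "H h = {e \<in> edges F. ec e \<noteq> h}" for h
  define M where "M h = {e \<in> edges G - edges F. \<mu> e = h}" for h
  have sub: "H h \<subseteq> edges G" "M h \<subseteq> edges G" "M h \<inter> H h = {}" for h
    using F'(2) by (auto simp: H_def M_def)
  have H_even: "even (deg (H h) v)" if v: "v \<in> verts G" and h: "h \<in> {1, 2, 3}" for v h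
  proof -
    let ?I = "{e \<in> edges F. v \<in> ends G e}"
    have H_at: "{e \<in> H h. v \<in> ends G e} = {e \<in> ?I. ec e \<noteq> h}" by (auto simp: H_def)
    from at[OF v] show ?thesis
    proof (elim disjE conjE)
      assume img: "ec ` ?I = {1, 2, 3}" and c3: "card ?I = 3"
      have "inj_on ec ?I" using img c3 fin(3) by (intro eq_card_imp_inj_on) auto
      then have "inj_on ec {e \<in> ?I. ec e \<noteq> h}" by (rule inj_on_subset) auto
      then have "card {e \<in> ?I. ec e \<noteq> h} = card (ec ` {e \<in> ?I. ec e \<noteq> h})" by (simp add: card_image)
      also have "ec ` {e \<in> ?I. ec e \<noteq> h} = ec ` ?I - {h}" by auto
      also have "card \<dots> = 2" using img h by auto
      finally show ?thesis by (simp add: deg_def H_at)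
    next
      assume img: "ec ` ?I = {vc v}" and c2: "card ?I = 2"
      then have "ec e = vc v" if "e \<in> ?I" for e using that by blast
      then have "{e \<in> ?I. ec e \<noteq> h} = (if vc v = h then {} else ?I)" by auto
      then show ?thesis using c2 by (simp add: deg_def H_at)
    qed
  qed
  have M_at: "vdegree v (component_at F v) = 2 \<and> vc v \<noteq> h"
    if v: "v \<in> verts G" and M: "deg (M h) v \<noteq> 0" for v h
  proof -
    have "{e \<in> M h. v \<in> ends G e} \<noteq> {}" using M by (metis deg_def card.empty)
    then obtain e where e: "e \<in> edges G - edges F" "\<mu> e = h" "v \<in> ends G e" by (auto simp: M_def)
    then have "card {e \<in> edges G - edges F. v \<in> ends G e} \<noteq> 0" using fin by auto
    then have "vdegree v (component_at F v) = 2"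
      using connecting_edges_at[OF G F(1) _ tri[OF comp[OF v]]] v F(2) by (auto split: if_splits)
    moreover have "h \<notin> vc ` ends G e" using \<mu>[OF e(1)] e(2) by blast
    ultimately show ?thesis using e(3) by blast
  qed
  \<comment> \<open>a set closed under \<open>H h\<close> contains all or none of the ends of \<open>M h\<close> in each component\<close>
  have "\<exists>J\<subseteq>H h. \<forall>v\<in>verts G. even (deg (M h) v + half_degree p q J v)" if h: "h \<in> {1, 2, 3}" for h
  proof (rule join_exists)
    show "finite (H h)" "finite (verts G)" using fin by (auto simp: H_def)
    fix Z assume Z: "Z \<subseteq> verts G" "edge_closed p q (H h) Z"
    have "even (sum (deg (M h)) {v \<in> Z. component_at F v = D})" if D: "D \<in> component_at F ` verts G" for D
    proof -
      have compD: "component D F" using D comp by auto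
      then have subD: "verts D \<subseteq> verts G" "edges D \<subseteq> edges F" "ends D = ends G"
        using F(2) F'(3) by (auto simp: component_def subgraph_def)
      have "{v \<in> Z. component_at F v = D} = Z \<inter> verts D"
      proof (intro set_eqI)
        fix v
        show "v \<in> {v \<in> Z. component_at F v = D} \<longleftrightarrow> v \<in> Z \<inter> verts D"
          using component_iff[OF F'(1), of D v] compD Z(1) F(2) by auto
      qed
      have at_D: "component_at F v = D" if "v \<in> verts D" for v
        using component_iff[OF F'(1), of D v] compD that by simp
      show ?thesis
      proof (cases "\<exists>v\<in>Z \<inter> verts D. deg (M h) v \<noteq> 0")
        case False
        then show ?thesis using \<open>{v \<in> Z. component_at F v = D} = Z \<inter> verts D\<close> by simp
      next
        case True
        then obtain u where u: "u \<in> Z" "u \<in> verts D" "deg (M h) u \<noteq> 0" by blast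
        have "edge_saturated D {e \<in> edges D. ec e \<noteq> h} Z"
          unfolding edge_saturated_def
        proof
          fix e assume "e \<in> {e \<in> edges D. ec e \<noteq> h}"
          then have "e \<in> H h" using subD by (auto simp: H_def)
          then have "p e \<in> Z \<longleftrightarrow> q e \<in> Z" "ends D e = {p e, q e}"
            using Z(2) pq sub(1) subD(3) by (auto simp: edge_closed_def)
          then show "ends D e \<subseteq> Z \<or> ends D e \<inter> Z = {}" by auto
        qed
        then have link: "\<forall>u\<in>verts D. \<forall>v\<in>verts D.
            vdegree u D = 2 \<and> vdegree v D = 2 \<and> vc u \<noteq> h \<and> vc v \<noteq> h \<longrightarrow> (u \<in> Z \<longleftrightarrow> v \<in> Z)"
          using tri[OF compD] h unfolding tricolored_def by blast
        have at_2: "vdegree v D = 2 \<and> vc v \<noteq> h" if "v \<in> verts D" "deg (M h) v \<noteq> 0" for v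
          using M_at[of v h] that subD(1) at_D by auto
        have "v \<in> Z" if v: "v \<in> verts D" "deg (M h) v \<noteq> 0" for v
          using link[rule_format, OF u(2) v(1)] at_2[OF u(2,3)] at_2[OF v] u(1) by simp
        then have "sum (deg (M h)) (Z \<inter> verts D) = sum (deg (M h)) (verts D)"
          using fin(1) subD(1) finite_subset by (intro sum.mono_neutral_left) auto
        then show ?thesis
          using par[OF compD h] \<open>{v \<in> Z. component_at F v = D} = Z \<inter> verts D\<close>
          by (simp add: deg_def[abs_def] M_def)
      qed
    qed
    then have "even (\<Sum>D\<in>component_at F ` verts G. sum (deg (M h)) {v \<in> Z. component_at F v = D})"
      by (rule dvd_sum)
    also have "(\<Sum>D\<in>component_at F ` verts G. sum (deg (M h)) {v \<in> Z. component_at F v = D}) =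
        sum (deg (M h)) Z"
      using Z(1) fin(1) finite_subset by (intro sum.group) auto
    finally show "even (sum (deg (M h)) Z)" .
  qed
  then obtain J where J: "\<And>h. h \<in> {1, 2, 3} \<Longrightarrow> J h \<subseteq> H h"
      "\<And>h v. h \<in> {1, 2, 3} \<Longrightarrow> v \<in> verts G \<Longrightarrow> even (deg (M h) v + half_degree p q (J h) v)"
    by metis
  have J_even: "even (deg (M h \<union> J h) v) \<and> even (deg (M h \<union> (H h - J h)) v)"
    if h: "h \<in> {1, 2, 3}" and v: "v \<in> verts G" for h v
  proof -
    note JH = J(1)[OF h]
    have JG: "J h \<subseteq> edges G" using JH sub(1) by blast
    have "deg (M h \<union> J h) v = deg (M h) v + deg (J h) v"
      using JH JG sub by (intro deg_Un) blast+
    moreover have "deg (M h \<union> (H h - J h)) v = deg (M h) v + deg (H h - J h) v"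
      using JH sub by (intro deg_Un) blast+
    moreover have "deg (H h) v = deg (J h) v + deg (H h - J h) v"
    proof -
      have "J h \<union> (H h - J h) = H h" using JH by blast
      then show ?thesis using deg_Un[of "J h" "H h - J h" v] JG sub(1)[of h] by auto
    qed
    moreover have "even (deg (M h) v + deg (J h) v)" using J(2)[OF h v] deg_half[OF JG] by simp
    ultimately show ?thesis using H_even[OF v h] by simp
  qed
  define A where "A i = (if i < 3 then M (i + 1) \<union> J (i + 1) else M (i - 2) \<union> (H (i - 2) - J (i - 2)))"
    for i :: nat
  have index: "i < 3 \<and> i + 1 \<in> {1, 2, 3} \<or> \<not> i < 3 \<and> i - 2 \<in> {1, 2, 3}" if "i < 6" for i :: nat
    using that by auto
  have "A i \<subseteq> edges G" if "i < 6" for i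
  proof -
    have "M h \<union> J h \<subseteq> edges G" "M h \<union> (H h - J h) \<subseteq> edges G" if "h \<in> {1, 2, 3}" for h
      using J(1)[OF that] sub(1,2)[of h] by blast+
    then show ?thesis using index[OF that] unfolding A_def by presburger
  qed
  moreover have "even (card {e \<in> A i. v \<in> ends G e})" if "i < 6" "v \<in> verts G" for i v
    using index[OF that(1)] J_even[OF _ that(2)] unfolding A_def deg_def by presburger
  moreover have "card {i \<in> {..<6}. e \<in> A i} = 2" if e: "e \<in> edges G" for e
  proof -
    have "card {i \<in> {..<6}. e \<in> A i} = (\<Sum>i<6. of_bool (e \<in> A i))"
      by (simp add: sum_of_bool_eq Int_def)
    also have "\<dots> = of_bool (e \<in> M 1 \<union> J 1) + of_bool (e \<in> M 2 \<union> J 2) + of_bool (e \<in> M 3 \<union> J 3)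
        + of_bool (e \<in> M 1 \<union> (H 1 - J 1)) + of_bool (e \<in> M 2 \<union> (H 2 - J 2))
        + of_bool (e \<in> M 3 \<union> (H 3 - J 3))"
      by (simp add: A_def eval_nat_numeral)
    also have "\<dots> = 2"
    proof (cases "e \<in> edges F")
      case False
      then have "e \<notin> H h" for h by (simp add: H_def)
      moreover from this have "e \<notin> J 1" "e \<notin> J 2" "e \<notin> J 3" using J(1) by blast+
      moreover have "\<mu> e = 1 \<or> \<mu> e = 2 \<or> \<mu> e = 3" "\<And>h. e \<in> M h \<longleftrightarrow> \<mu> e = h"
        using \<mu>[of e] e False by (auto simp: M_def)
      ultimately show ?thesis by auto
    next
      case True
      obtain v where v: "v \<in> ends G e" "v \<in> verts G" using edge_has_end[OF G(1) e] .
      have "ec e \<in> ec ` {e \<in> edges F. v \<in> ends G e}" using True v by blast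
      then have "ec e = 1 \<or> ec e = 2 \<or> ec e = 3" using at[OF v(2)] by auto
      moreover have "e \<notin> M h" "e \<in> H h \<longleftrightarrow> ec e \<noteq> h" for h using True by (auto simp: M_def H_def)
      moreover have "e \<notin> J h" if "e \<notin> H h" "h \<in> {1, 2, 3}" for h using that J(1) by blast
      ultimately show ?thesis by auto
    qed
    finally show ?thesis .
  qed
  ultimately show ?thesis by blast
qed

section \<open>Well connected Kotzig frames\<close>

lemma tricolored_perfect_K_component:
  assumes "multigraph G" "cubic G" "kotzig_frame G F" "perfect_coloring F \<alpha>" "K_component D F"
  shows "tricolored D (vcol \<alpha>) (ecol \<alpha>)"
proof -
  have D: "component D F" "even (card (verts D))"
    using assms(3,5) by (auto simp: K_component_def kotzig_frame_def)
  have "subgraph D F" "subgraph F G" using D(1) assms(3) by (auto simp: component_def kotzig_frame_def)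
  then have sub: "verts D \<subseteq> verts G" "edges D \<subseteq> edges G" "ends D = ends G"
    by (auto simp: subgraph_def)
  have deg: "vdegree v D \<le> 3" if "v \<in> verts D" for v
  proof -
    have "vdegree v D \<le> vdegree v G"
      unfolding vdegree_def using sub assms(1) by (intro card_mono) (auto simp: multigraph_def)
    then show ?thesis using assms(2) sub(1) that by (auto simp: cubic_def)
  qed
  have "perfect_subdivision_coloring D \<alpha>" using assms(4,5) by (simp add: perfect_coloring_def)
  then obtain K P c where *: "kotzig_graph K" "subdivision D K P" "kotzig_coloring K c"
      "\<forall>e\<in>edges K. \<forall>f\<in>edges (P e). c e = ecol \<alpha> f"
      "\<forall>v\<in>verts D. vdegree v D = 2 \<longrightarrow> (\<forall>e\<in>edges D. v \<in> ends D e \<longrightarrow> vcol \<alpha> v = ecol \<alpha> e)"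
    unfolding perfect_subdivision_coloring_def by blast
  show ?thesis
    by (rule tricolored_kotzig_subdivision[OF *(2) D(2) deg *(1,3)]) (use *(4,5) in auto)
qed

theorem theorem5:
  fixes G :: "('v, 'e) mgraph"
  assumes "multigraph G" and "two_connected G" and "cubic G"
    and "\<exists>F. kotzig_frame G F \<and> well_connected G F"
  shows "\<exists>S. k_cycle_double_cover 6 G S"
proof -
  note G = assms(1,3)
  obtain F where F: "kotzig_frame G F" "well_connected G F" using assms(4) by blast
  obtain \<alpha> H c0 where \<alpha>: "perfect_coloring F \<alpha>"
    and H: "subgraph H (contracted G F)" "graph_connected H" "{D. K_component D F} \<subseteq> verts H"
      "\<And>e. e \<in> edges H \<Longrightarrow> contracted_color G \<alpha> e = Some c0"
    using F(2) unfolding well_connected_def by blast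
  have sub: "subgraph F G" "verts F = verts G" using F(1) by (auto simp: kotzig_frame_def)
  then have F': "multigraph F" "ends F = ends G" by (auto simp: subgraph_def)
  have fin: "finite (verts G)" "finite (edges G)" using G(1) by (auto simp: multigraph_def)
  obtain p q where pq: "\<And>e. e \<in> edges G \<Longrightarrow> ends G e = {p e, q e} \<and> p e \<noteq> q e"
    using ends_eq_pair[OF G(1)] by blast
  then have pq_in: "p e \<in> verts G \<and> q e \<in> verts G" if "e \<in> edges G" for e
    using G(1) that unfolding multigraph_def by blast
  define \<kappa> where "\<kappa> = component_at F"
  have \<kappa>: "component D F \<and> v \<in> verts D \<longleftrightarrow> v \<in> verts G \<and> D = \<kappa> v" for D v
    using component_iff[OF F'(1)] sub(2) by (simp add: \<kappa>_def)
  define V where "V = {D. component D F}"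
  have V_eq: "V = \<kappa> ` verts G"
  proof -
    have "\<exists>v. v \<in> verts D" if "component D F" for D
      using that by (auto simp: component_def graph_connected_def)
    then show ?thesis using \<kappa> by (fastforce simp: V_def)
  qed
  define E where "E = edges G - edges F"
  have E: "finite E" "E \<subseteq> edges G" using fin by (auto simp: E_def)
  have H': "multigraph H" "verts H \<subseteq> V" "edges H \<subseteq> E"
    "ends H = (\<lambda>e. {D. component D F \<and> ends G e \<inter> verts D \<noteq> {}})"
    using H(1) by (auto simp: subgraph_def contracted_def V_def E_def)
  have ends_H: "ends H e = {\<kappa> (p e), \<kappa> (q e)}" if "e \<in> E" for e
  proof -
    have e: "ends G e = {p e, q e}" "p e \<in> verts G" "q e \<in> verts G"
      using pq pq_in E(2) that by auto
    then have "component D F \<and> ends G e \<inter> verts D \<noteq> {} \<longleftrightarrow> D = \<kappa> (p e) \<or> D = \<kappa> (q e)" for D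
      using \<kappa>[of D "p e"] \<kappa>[of D "q e"] by auto
    then show ?thesis unfolding H'(4) by blast
  qed
  have H_color: "vcol \<alpha> (p e) = c0 \<and> vcol \<alpha> (q e) = c0" if "e \<in> edges H" for e
  proof -
    have "\<exists>c. vcol \<alpha> ` ends G e = {c}" "the_elem (vcol \<alpha> ` ends G e) = c0"
      using H(4)[OF that] unfolding contracted_color_def by (metis option.distinct(1) option.inject)+
    then have "vcol \<alpha> ` ends G e = {c0}" by (metis the_elem_eq)
    moreover have "ends G e = {p e, q e}" using pq[of e] that H'(3) E(2) by auto
    ultimately show ?thesis by (metis insertCI imageI singletonD)
  qed
  \<comment> \<open>If \<open>H\<close> is a single vertex, then \<open>c0\<close> is arbitrary and need not be one of the three colours.\<close>
  define c where "c = (if edges H = {} then 1 else c0)"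
  have c: "c \<in> {1, 2, 3}"
  proof (cases "edges H = {}")
    case False
    then obtain e where e: "e \<in> edges H" by blast
    then have "p e \<in> verts F" using pq_in H'(3) E(2) sub(2) by auto
    moreover have "three_total_coloring F \<alpha>" using \<alpha> by (simp add: perfect_coloring_def)
    ultimately have "vcol \<alpha> (p e) \<in> {1, 2, 3}" by (simp add: three_total_coloring_def)
    then show ?thesis using H_color[OF e] False by (simp add: c_def)
  qed (simp add: c_def)
  obtain a b where abc: "a \<noteq> b" "a \<noteq> c" "b \<noteq> c" "{a, b, c} = {1, 2, 3::nat}"
  proof -
    consider "c = 1" | "c = 2" | "c = 3" using c by blast
    then show ?thesis
      by cases (rule that[of 2 3] that[of 1 3] that[of 1 2]; force)+
  qed
  \<comment> \<open>Cycles may be recoloured: \<open>c\<close> on those in \<open>H\<close>, so that all edges of \<open>H\<close> join ends of colour \<open>c\<close>;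
      on the others a colour that leaves only two possible values of \<open>\<mu>\<close> at each of them.\<close>
  define base where "base D = (if D \<in> verts H then c else a)" for D :: "('v, 'e) mgraph"
  define VC where "VC D = (if K_component D F then vcol \<alpha> else (\<lambda>_. base D))" for D
  define EC where "EC D = (if K_component D F then ecol \<alpha> else (\<lambda>_. base D))" for D
  have base: "base D \<in> {1, 2, 3}" for D using abc(4) c by (auto simp: base_def)
  have tri: "tricolored D (VC D) (EC D)" if D: "component D F" for D
  proof (cases "K_component D F")
    case True
    then show ?thesis
      using tricolored_perfect_K_component[OF G F(1) \<alpha>] by (simp add: VC_def EC_def)
  next
    case False
    then have "cycle_graph D" "even (card (verts D))"
      using F(1) D by (auto simp: kotzig_frame_def C_component_def)
    then show ?thesis using tricolored_cycle[OF _ _ base] False by (simp add: VC_def EC_def)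
  qed
  define vc where "vc v = VC (\<kappa> v) v" for v
  have comp: "component (\<kappa> v) F" "v \<in> verts (\<kappa> v)" if "v \<in> verts G" for v
    using \<kappa>[of "\<kappa> v" v] that by auto
  have free: "card {e \<in> E. v \<in> ends G e} = (if vdegree v (\<kappa> v) = 2 then 1 else 0)"
    if "v \<in> verts G" for v
    using connecting_edges_at[OF G sub(1)] tri[OF comp(1)[OF that]] that sub(2)
    by (simp add: \<kappa>_def E_def)
  have vc_range: "vc v \<in> {a, b, c}" if v: "v \<in> verts G" "e \<in> E" "v \<in> ends G e" for v e
  proof -
    have "card {e \<in> E. v \<in> ends G e} \<noteq> 0" using v E(1) by auto
    then have "vdegree v (\<kappa> v) = 2" using free[OF v(1)] by (auto split: if_splits)
    then show ?thesis
      using tri[OF comp(1)[OF v(1)]] comp(2)[OF v(1)] unfolding tricolored_def vc_def abc(4) by force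
  qed
  have half_sum: "half_degree (\<kappa> \<circ> p) (\<kappa> \<circ> q) J D = (\<Sum>v\<in>verts D. card {e \<in> J. v \<in> ends G e})"
    if J: "J \<subseteq> E" and D: "D \<in> V" for J D
  proof -
    have D': "component D F" using D by (simp add: V_def)
    then have "finite (verts D)" by (auto simp: component_def subgraph_def multigraph_def)
    moreover have finJ: "finite J" using J E(1) finite_subset by blast
    moreover have "card {e \<in> J. v \<in> ends G e} = half_degree p q J v" for v
      using finJ J E(2) pq by (intro card_incident_eq_half_degree) auto
    ultimately have "(\<Sum>v\<in>verts D. card {e \<in> J. v \<in> ends G e}) =
        card {e \<in> J. p e \<in> verts D} + card {e \<in> J. q e \<in> verts D}"
      by (simp add: sum_half_degree)
    moreover have "p e \<in> verts D \<longleftrightarrow> \<kappa> (p e) = D" "q e \<in> verts D \<longleftrightarrow> \<kappa> (q e) = D" if "e \<in> J" for e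
      using \<kappa>[of D "p e"] \<kappa>[of D "q e"] D' pq_in[of e] that J E(2) by auto
    ultimately show ?thesis
      by (simp add: half_degree_def cong: conj_cong)
  qed
  have total: "even (half_degree (\<kappa> \<circ> p) (\<kappa> \<circ> q) E D)" if D: "D \<in> V" for D
  proof -
    have D': "component D F" using D by (simp add: V_def)
    have "half_degree (\<kappa> \<circ> p) (\<kappa> \<circ> q) E D = (\<Sum>v\<in>verts D. if vdegree v D = 2 then 1 else 0)"
      unfolding half_sum[OF subset_refl D]
    proof (rule sum.cong[OF refl])
      fix v assume "v \<in> verts D"
      then have "v \<in> verts G" "D = \<kappa> v" using \<kappa>[of D v] D' by auto
      then show "card {e \<in> E. v \<in> ends G e} = (if vdegree v D = 2 then 1 else 0)"
        using free by simp
    qed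
    also have "\<dots> = card {v \<in> verts D. vdegree v D = 2}"
      using D' by (subst sum.inter_filter[symmetric])
        (auto simp: component_def subgraph_def multigraph_def)
    finally show ?thesis using tri[OF D'] by (simp add: tricolored_def)
  qed
  have inV: "\<kappa> (p e) \<in> V \<and> \<kappa> (q e) \<in> V" if "e \<in> E" for e
    using pq_in[of e] E(2) that by (auto simp: V_eq)
  have ends_range: "vc (p e) \<in> {a, b, c} \<and> vc (q e) \<in> {a, b, c}" if "e \<in> E" for e
    using vc_range[of "p e" e] vc_range[of "q e" e] pq_in[of e] pq[of e] E(2) that by auto
  have edge_H: "\<kappa> (p e) \<in> verts H \<and> \<kappa> (q e) \<in> verts H \<and> vc (p e) = c \<and> vc (q e) = c"
    if e: "e \<in> edges H" for e
  proof -
    have "ends H e \<subseteq> verts H" using H'(1) e unfolding multigraph_def by blast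
    moreover have "c = c0" using e by (auto simp: c_def)
    ultimately show ?thesis
      using ends_H[of e] e H'(3) H_color[OF e] by (auto simp: vc_def VC_def base_def)
  qed
  have conn: "Z = {} \<or> Z = verts H"
    if Z: "Z \<subseteq> verts H" "edge_closed (\<kappa> \<circ> p) (\<kappa> \<circ> q) (edges H) Z" for Z
  proof -
    have "edge_saturated H (edges H) Z"
      using Z(2) ends_H H'(3) by (fastforce simp: edge_closed_def edge_saturated_def)
    then show ?thesis using connected_saturated[OF H(2)] Z(1) by blast
  qed
  have outside: "vc v = a" if "\<kappa> v \<in> V - verts H" for v
    using that H(3) by (auto simp: vc_def VC_def base_def)
  have "finite V" using fin by (simp add: V_eq)
  obtain W \<mu> where W: "let vc' = (\<lambda>v. if \<kappa> v \<in> W then transpose a b (vc v) else vc v) in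
     (\<forall>e\<in>E. \<mu> e \<in> {a, b, c} - {vc' (p e), vc' (q e)}) \<and>
     (\<forall>x\<in>V. \<forall>h\<in>{a, b, c}. even (half_degree (\<kappa> \<circ> p) (\<kappa> \<circ> q) {e \<in> E. \<mu> e = h} x))"
    using parity_assignment[OF E(1) \<open>finite V\<close> H'(2) inV abc(1-3) ends_range total H'(3)
        edge_H conn outside] by blast
  define vc' where "vc' v = (if \<kappa> v \<in> W then transpose a b (vc v) else vc v)" for v
  define EC' where "EC' D = (if D \<in> W then transpose a b \<circ> EC D else EC D)" for D
  define ec' where "ec' e = EC' (\<kappa> (p e)) e" for e
  have \<mu>: "\<mu> e \<in> {1, 2, 3} - {vc' (p e), vc' (q e)}" if "e \<in> E" for e
    using W that unfolding Let_def abc(4) vc'_def by blast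
  have par: "even (half_degree (\<kappa> \<circ> p) (\<kappa> \<circ> q) {e \<in> E. \<mu> e = h} D)" if "D \<in> V" "h \<in> {1, 2, 3}" for D h
    using W that unfolding Let_def abc(4) by blast
  have "tricolored D vc' ec'" if D: "component D F" for D
  proof (rule tricolored_cong)
    have "a \<in> {1, 2, 3}" "b \<in> {1, 2, 3}" using abc(4) by blast+
    then show "tricolored D (if D \<in> W then transpose a b \<circ> VC D else VC D) (EC' D)"
      using tri[OF D] tricolored_transpose[OF tri[OF D]] by (simp add: EC'_def)
    show "vc' v = (if D \<in> W then transpose a b \<circ> VC D else VC D) v" if "v \<in> verts D" for v
      using \<kappa>[of D v] D that by (simp add: vc'_def vc_def)
    show "ec' e = EC' D e" if e: "e \<in> edges D" for e
    proof -
      have "subgraph D F" using D by (simp add: component_def)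
      then have "ends G e \<subseteq> verts D" "e \<in> edges G"
        using e sub(1) unfolding subgraph_def multigraph_def by (metis, blast)
      then have "p e \<in> verts D" using pq by auto
      then have "\<kappa> (p e) = D" using \<kappa>[of D "p e"] D by simp
      then show ?thesis by (simp add: ec'_def)
    qed
  qed
  moreover have "\<mu> e \<in> {1, 2, 3} - vc' ` ends G e" if "e \<in> edges G - edges F" for e
    using \<mu>[of e] pq[of e] that by (auto simp: E_def)
  moreover have "even (\<Sum>v\<in>verts D. card {e \<in> {e \<in> edges G - edges F. \<mu> e = h}. v \<in> ends G e})"
    if "component D F" "h \<in> {1, 2, 3}" for D h
  proof -
    have D: "D \<in> V" using that(1) by (simp add: V_def)
    have "{e \<in> E. \<mu> e = h} \<subseteq> E" by blast
    from half_sum[OF this D] par[OF D that(2)] show ?thesis unfolding E_def by simp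
  qed
  ultimately obtain A :: "nat \<Rightarrow> 'e set" where "\<forall>i<6. A i \<subseteq> edges G"
      "\<forall>i<6. \<forall>v\<in>verts G. even (card {e \<in> A i. v \<in> ends G e})"
      "\<forall>e\<in>edges G. card {i \<in> {..<6}. e \<in> A i} = 2"
    using six_even_edge_sets[OF G sub, of vc' ec' \<mu>] by blast
  then show ?thesis
    by (intro k_cycle_double_cover_of_even_edge_sets[OF G, of 6 A]) blast+
qed

end
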